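(* Let $H$ and $K$ be $n\times n$ Hermitian matrices such that $mI\leq K,H\leq MI$ for some real scalars $m\leq M$, and let $\alpha\in[0,1]$. Then for every $p>0$ and $k=1,\dots,n$, $$\lambda_k\big(e^{(1-\alpha)H+\alpha K}\big)\leq K\big(e^{2p(M-m)},\alpha\big)^{-1/p}\,\lambda_k\big(e^{pH}\sharp_\alpha e^{pK}\big)^{1/p},$$ and the right-hand side converges to the left-hand side as $p\downarrow0$. In particular, for $k=1,\dots,n$, $$\lambda_k(e^{H+K})\leq\frac{e^{2M}+e^{2m}}{2e^Me^m}\,\lambda_k(e^{2H}\sharp e^{2K}),$$ where $\sharp=\sharp_{1/2}$.
   Context: For Hermitian matrices, $X\leq Y$ means $Y-X$ is positive semidefinite. For positive definite $A,B$ and $\alpha\in[0,1]$, $A\sharp_\alpha B=A^{1/2}(A^{-1/2}BA^{-1/2})^\alpha A^{1/2}$. For Hermitian $X$, $\lambda_1(X)\geq\cdots\geq\lambda_n(X)$ are its eigenvalues in decreasing order and $\lambda_k(X)^{1/p}=(\lambda_k(X))^{1/p}$. The generalized Kantorovich constant is, for $w>0$, $$K(w,\alpha)=\frac{w^\alpha-w}{(\alpha-1)(w-1)}\left(\frac{\alpha-1}{\alpha}\cdot\frac{w^\alpha-1}{w^\alpha-w}\right)^\alpha,$$ with its value at $w=1$ or $\alpha\in\{0,1\}$ understood as the limiting value, namely $1$. *)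

theory Defs
  imports "Jordan_Normal_Form.Schur_Decomposition"
begin

definition hermitian_mat :: "nat \<Rightarrow> complex mat \<Rightarrow> bool" where
  "hermitian_mat n A \<longleftrightarrow> A \<in> carrier_mat n n \<and> mat_adjoint A = A"

definition unitary_mat :: "nat \<Rightarrow> complex mat \<Rightarrow> bool" where
  "unitary_mat n U \<longleftrightarrow> U \<in> carrier_mat n n \<and> mat_adjoint U * U = 1\<^sub>m n"

definition psd_mat :: "nat \<Rightarrow> complex mat \<Rightarrow> bool" where
  "psd_mat n A \<longleftrightarrow> hermitian_mat n A \<and>
     (\<forall>v \<in> carrier_vec n. 0 \<le> Re (conjugate v \<bullet> (A *\<^sub>v v)))"

definition pd_mat :: "nat \<Rightarrow> complex mat \<Rightarrow> bool" where
  "pd_mat n A \<longleftrightarrow> hermitian_mat n A \<and>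
     (\<forall>v \<in> carrier_vec n. v \<noteq> 0\<^sub>v n \<longrightarrow> 0 < Re (conjugate v \<bullet> (A *\<^sub>v v)))"

definition loewner_le :: "nat \<Rightarrow> complex mat \<Rightarrow> complex mat \<Rightarrow> bool" where
  "loewner_le n X Y \<longleftrightarrow> hermitian_mat n X \<and> hermitian_mat n Y \<and> psd_mat n (Y - X)"

definition mat_exp :: "complex mat \<Rightarrow> complex mat" where
  "mat_exp A = mat (dim_row A) (dim_col A)
     (\<lambda>(i,j). \<Sum>k. (A ^\<^sub>m k) $$ (i,j) / of_nat (fact k))"

definition diag_of :: "nat \<Rightarrow> (nat \<Rightarrow> real) \<Rightarrow> complex mat" where
  "diag_of n d = mat n n (\<lambda>(i,j). if i = j then complex_of_real (d i) else 0)"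

text \<open>Real power A^t of a positive definite matrix, via its spectral decomposition
  A = U diag(d) U^* (the result is independent of the chosen decomposition).\<close>
definition mat_powr :: "nat \<Rightarrow> complex mat \<Rightarrow> real \<Rightarrow> complex mat" where
  "mat_powr n A t = (THE B. \<exists>U d. unitary_mat n U \<and> (\<forall>i<n. 0 < d i) \<and>
      A = U * diag_of n d * mat_adjoint U \<and>
      B = U * diag_of n (\<lambda>i. d i powr t) * mat_adjoint U)"

definition geo_mean :: "nat \<Rightarrow> real \<Rightarrow> complex mat \<Rightarrow> complex mat \<Rightarrow> complex mat" where
  "geo_mean n \<alpha> A B = mat_powr n A (1/2) *
     mat_powr n (mat_powr n A (-1/2) * B * mat_powr n A (-1/2)) \<alpha> * mat_powr n A (1/2)"

text \<open>Eigenvalues (with multiplicity, as roots of the characteristic polynomial)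
  of a Hermitian matrix, listed in decreasing order; eig n A k = lambda_k(A), k = 1..n.\<close>
definition eig_list :: "nat \<Rightarrow> complex mat \<Rightarrow> real list" where
  "eig_list n A = (THE xs. length xs = n \<and> sorted_wrt (\<ge>) xs \<and>
      char_poly A = (\<Prod>x \<leftarrow> xs. [:- complex_of_real x, 1:]))"

definition eig :: "nat \<Rightarrow> complex mat \<Rightarrow> nat \<Rightarrow> real" where
  "eig n A k = eig_list n A ! (k - 1)"

text \<open>Generalized Kantorovich constant, with limiting value 1 at w = 1 or \<alpha> \<in> {0,1}.\<close>
definition kantorovich :: "real \<Rightarrow> real \<Rightarrow> real" where
  "kantorovich w \<alpha> = (if w = 1 \<or> \<alpha> = 0 \<or> \<alpha> = 1 then 1 else
     (w powr \<alpha> - w) / ((\<alpha> - 1) * (w - 1)) *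
     (((\<alpha> - 1) / \<alpha>) * ((w powr \<alpha> - 1) / (w powr \<alpha> - w))) powr \<alpha>)"

end

theory Submission
  imports Defs "Jordan_Normal_Form.Spectral_Radius" "HOL-Combinatorics.Permutations"
    "HOL-Real_Asymp.Real_Asymp"
begin

text \<open>
  Everything is reduced to quadratic forms. If \<open>f\<close> is increasing and
  \<open>f \<langle>Xv, v\<rangle> \<le> \<langle>Yv, v\<rangle>\<close> for all unit vectors \<open>v\<close>, then the Courant--Fischer
  principle gives \<open>f (\<lambda>\<^sub>k X) \<le> \<lambda>\<^sub>k Y\<close>. Put \<open>A = exp (pH)\<close>, \<open>B = exp (pK)\<close> and
  \<open>X = (1 - \<alpha>)H + \<alpha>K\<close>. For every \<open>t > 0\<close>, convexity of the exponential and Jensen's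
  inequality for the spectral measures of \<open>H\<close> and \<open>K\<close> bound \<open>exp (p \<langle>Xv, v\<rangle>)\<close> by
  \<open>t powr \<alpha> * \<langle>((1 - \<alpha>)A + (\<alpha>/t)B)v, v\<rangle>\<close>. The Kantorovich constant is exactly the number
  for which, at the right \<open>t\<close>, \<open>K(w,\<alpha>)\<close> times the tangent of \<open>x powr \<alpha>\<close> at \<open>t\<close> is its chord,
  so this is at most \<open>1 / K(w,\<alpha>)\<close> times the quadratic form of the geometric mean. No
  operator monotonicity of the logarithm is needed.

  For the limit, the arithmetic-geometric mean inequality and \<open>exp y \<le> 1 + y + 2y\<^sup>2\<close> bound
  the eigenvalues of the geometric mean from above by \<open>1 + p \<lambda>\<^sub>k X + O(p\<^sup>2)\<close>, while
  \<open>ln K(exp (2pD), \<alpha>) = o(p)\<close>.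
\<close>

section \<open>Quadratic forms and spectral representations\<close>

text \<open>For Hermitian \<open>A\<close> the form is real, so \<open>Re\<close> loses nothing;
  this is the expression tested in \<open>psd_mat\<close>.\<close>

definition qform :: "complex mat \<Rightarrow> complex vec \<Rightarrow> real" where
  "qform A v = Re (conjugate v \<bullet> (A *\<^sub>v v))"

definition sqnorm :: "complex vec \<Rightarrow> real" where
  "sqnorm v = (\<Sum>i<dim_vec v. (cmod (v $ i))\<^sup>2)"

lemma mat_adjoint_dim [simp]:
  "dim_row (mat_adjoint A) = dim_col A" "dim_col (mat_adjoint A) = dim_row A"
  by (simp_all add: mat_adjoint_def)

lemma mat_adjoint_carrier [simp, intro]:
  "A \<in> carrier_mat nr nc \<Longrightarrow> mat_adjoint A \<in> carrier_mat nc nr"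
  by (intro carrier_matI) auto

lemma mat_adjoint_index [simp]:
  fixes A :: "complex mat"
  assumes "i < dim_col A" "j < dim_row A"
  shows "mat_adjoint A $$ (i, j) = cnj (A $$ (j, i))"
  using assms by (simp add: mat_adjoint_def mat_of_rows_index conjugate_complex_def)

lemma mat_adjoint_adjoint [simp]: "mat_adjoint (mat_adjoint A) = (A :: complex mat)"
  by (rule eq_matI) auto

lemma mat_adjoint_mult:
  fixes A B :: "complex mat"
  assumes "A \<in> carrier_mat nr n" "B \<in> carrier_mat n nc"
  shows "mat_adjoint (A * B) = mat_adjoint B * mat_adjoint A"
  using assms by (intro eq_matI) (auto simp: scalar_prod_def intro!: sum.cong)

lemma mat_adjoint_sprod:
  fixes A :: "complex mat"
  assumes "A \<in> carrier_mat nr nc" "v \<in> carrier_vec nr" "w \<in> carrier_vec nc"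
  shows "conjugate v \<bullet> (A *\<^sub>v w) = conjugate (mat_adjoint A *\<^sub>v v) \<bullet> w"
proof -
  have "conjugate v \<bullet> (A *\<^sub>v w) = (\<Sum>i<nr. \<Sum>j<nc. cnj (v $ i) * (A $$ (i, j) * w $ j))"
    using assms
    by (auto simp: scalar_prod_def conjugate_complex_def sum_distrib_left lessThan_atLeast0
        intro!: sum.cong)
  also have "\<dots> = (\<Sum>j<nc. \<Sum>i<nr. cnj (v $ i) * (A $$ (i, j) * w $ j))"
    by (rule sum.swap)
  also have "\<dots> = conjugate (mat_adjoint A *\<^sub>v v) \<bullet> w"
    using assms
    by (auto simp: scalar_prod_def conjugate_complex_def sum_distrib_left sum_distrib_right
        lessThan_atLeast0 mult_ac intro!: sum.cong)
  finally show ?thesis .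
qed

text \<open>Serves two purposes: with a unitary \<open>P\<close> it diagonalises forms, and with
  roots of a positive definite matrix it reduces the geometric mean to a spectral form.\<close>

lemma qform_congruence:
  assumes "F \<in> carrier_mat n n" "P \<in> carrier_mat n m" "v \<in> carrier_vec m"
  shows "qform (mat_adjoint P * F * P) v = qform F (P *\<^sub>v v)"
proof -
  have "(mat_adjoint P * F * P) *\<^sub>v v = mat_adjoint P * F *\<^sub>v (P *\<^sub>v v)"
    using assms by (intro assoc_mult_mat_vec[of _ m n _ m]) auto
  also have "\<dots> = mat_adjoint P *\<^sub>v (F *\<^sub>v (P *\<^sub>v v))"
    using assms by (intro assoc_mult_mat_vec[of _ m n _ n]) auto
  finally have "(mat_adjoint P * F * P) *\<^sub>v v = mat_adjoint P *\<^sub>v (F *\<^sub>v (P *\<^sub>v v))" .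
  then show ?thesis
    unfolding qform_def
    using mat_adjoint_sprod[of "mat_adjoint P" m n v "F *\<^sub>v (P *\<^sub>v v)"] assms by simp
qed

lemma qform_add:
  assumes "A \<in> carrier_mat n n" "B \<in> carrier_mat n n" "v \<in> carrier_vec n"
  shows "qform (A + B) v = qform A v + qform B v"
  using assms unfolding qform_def
  by (simp add: add_mult_distrib_mat_vec[of _ n n] scalar_prod_add_distrib[of _ n])

lemma qform_minus:
  assumes "A \<in> carrier_mat n n" "B \<in> carrier_mat n n" "v \<in> carrier_vec n"
  shows "qform (A - B) v = qform A v - qform B v"
  using assms unfolding qform_def
  by (simp add: minus_mult_distrib_mat_vec[of _ n n] scalar_prod_minus_distrib[of _ n])

lemma qform_smult:
  assumes "A \<in> carrier_mat n n" "v \<in> carrier_vec n"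
  shows "qform (complex_of_real c \<cdot>\<^sub>m A) v = c * qform A v"
proof -
  have "(complex_of_real c \<cdot>\<^sub>m A) *\<^sub>v v = complex_of_real c \<cdot>\<^sub>v (A *\<^sub>v v)"
    using assms by (intro eq_vecI) (auto simp: scalar_prod_def sum_distrib_left mult_ac)
  then show ?thesis using assms unfolding qform_def by simp
qed

lemma diag_of_carrier [simp, intro]: "diag_of n d \<in> carrier_mat n n"
  by (simp add: diag_of_def)

lemma diag_of_dim [simp]: "dim_row (diag_of n d) = n" "dim_col (diag_of n d) = n"
  by (simp_all add: diag_of_def)

lemma diag_of_index [simp]:
  "i < n \<Longrightarrow> j < n \<Longrightarrow> diag_of n d $$ (i, j) = (if i = j then complex_of_real (d i) else 0)"
  by (simp add: diag_of_def)

lemma diag_of_adjoint [simp]: "mat_adjoint (diag_of n d) = diag_of n d"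
  by (rule eq_matI) auto

lemma mult_diag_of_index:
  assumes "A \<in> carrier_mat m n" "i < m" "j < n"
  shows "(A * diag_of n d) $$ (i, j) = A $$ (i, j) * d j"
proof -
  have "(A * diag_of n d) $$ (i, j) = (\<Sum>l<n. A $$ (i, l) * diag_of n d $$ (l, j))"
    using assms by (simp add: scalar_prod_def lessThan_atLeast0)
  also have "\<dots> = (\<Sum>l<n. if l = j then A $$ (i, j) * d j else 0)"
    using assms by (intro sum.cong) auto
  finally show ?thesis using assms by simp
qed

lemma diag_of_mult_index:
  assumes "A \<in> carrier_mat n m" "i < n" "j < m"
  shows "(diag_of n d * A) $$ (i, j) = d i * A $$ (i, j)"
proof -
  have "(diag_of n d * A) $$ (i, j) = (\<Sum>l<n. diag_of n d $$ (i, l) * A $$ (l, j))"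
    using assms by (simp add: scalar_prod_def lessThan_atLeast0)
  also have "\<dots> = (\<Sum>l<n. if l = i then d i * A $$ (i, j) else 0)"
    using assms by (intro sum.cong) auto
  finally show ?thesis using assms by simp
qed

lemma diag_of_mult: "diag_of n d * diag_of n e = diag_of n (\<lambda>i. d i * e i)"
  by (rule eq_matI) (auto simp: diag_of_mult_index[of _ n n] simp del: index_mult_mat(1))

lemma diag_of_cong: "(\<And>i. i < n \<Longrightarrow> d i = e i) \<Longrightarrow> diag_of n d = diag_of n e"
  by (rule eq_matI) auto

lemma diag_of_one: "diag_of n (\<lambda>_. 1) = 1\<^sub>m n"
  by (rule eq_matI) auto

lemma qform_diag:
  assumes "v \<in> carrier_vec n"
  shows "qform (diag_of n d) v = (\<Sum>i<n. d i * (cmod (v $ i))\<^sup>2)"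
proof -
  have "(diag_of n d *\<^sub>v v) $ i = d i * v $ i" if "i < n" for i
  proof -
    have "(diag_of n d *\<^sub>v v) $ i = (\<Sum>l<n. diag_of n d $$ (i, l) * v $ l)"
      using that assms by (simp add: scalar_prod_def lessThan_atLeast0)
    also have "\<dots> = (\<Sum>l<n. if l = i then d i * v $ i else 0)"
      using that by (intro sum.cong) auto
    finally show ?thesis using that by simp
  qed
  then have "conjugate v \<bullet> (diag_of n d *\<^sub>v v) = (\<Sum>i<n. cnj (v $ i) * (d i * v $ i))"
    using assms by (auto simp: scalar_prod_def conjugate_complex_def lessThan_atLeast0)
  also have "\<dots> = (\<Sum>i<n. complex_of_real (d i * (cmod (v $ i))\<^sup>2))"
    by (intro sum.cong refl) (simp add: complex_norm_square mult_ac del: of_real_power)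
  finally show ?thesis by (simp add: qform_def del: of_real_mult)
qed

lemma qform_one: "v \<in> carrier_vec n \<Longrightarrow> qform (1\<^sub>m n) v = sqnorm v"
  using qform_diag[of v n "\<lambda>_. 1"] by (simp add: diag_of_one sqnorm_def)

lemma sqnorm_nonneg: "0 \<le> sqnorm v"
  by (simp add: sqnorm_def sum_nonneg)

lemma sqnorm_pos:
  assumes "v \<in> carrier_vec n" "v \<noteq> 0\<^sub>v n"
  shows "0 < sqnorm v"
proof -
  from assms obtain i where "i < n" "v $ i \<noteq> 0"
    by (metis carrier_vecD eq_vecI index_zero_vec)
  then show ?thesis using assms
    by (auto simp: sqnorm_def intro!: sum_pos2[of _ i])
qed

lemma sqnorm_smult: "sqnorm (c \<cdot>\<^sub>v v) = (cmod c)\<^sup>2 * sqnorm v"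
  by (simp add: sqnorm_def norm_mult power_mult_distrib sum_distrib_left)

section \<open>Unitary matrices and matrices with a prescribed spectrum\<close>

lemma unitary_matD:
  assumes "unitary_mat n U"
  shows "U \<in> carrier_mat n n" "mat_adjoint U \<in> carrier_mat n n"
    "mat_adjoint U * U = 1\<^sub>m n" "U * mat_adjoint U = 1\<^sub>m n"
  using assms mat_mult_left_right_inverse[of "mat_adjoint U" n U]
  by (auto simp: unitary_mat_def)

lemma unitary_adjoint:
  assumes "unitary_mat n U"
  shows "unitary_mat n (mat_adjoint U)"
  using unitary_matD[OF assms] by (simp add: unitary_mat_def)

lemma unitary_mult:
  assumes "unitary_mat n U" "unitary_mat n V"
  shows "unitary_mat n (U * V)"
proof -
  note U = unitary_matD[OF assms(1)] and V = unitary_matD[OF assms(2)]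
  have "mat_adjoint (U * V) * (U * V) = mat_adjoint V * (mat_adjoint U * (U * V))"
    using U(1,2) V(1,2) by (simp add: mat_adjoint_mult[of _ n n] assoc_mult_mat[of _ n n _ n _ n])
  also have "mat_adjoint U * (U * V) = V"
    using U V by (simp add: assoc_mult_mat[of _ n n _ n _ n, symmetric])
  finally show ?thesis using U V by (simp add: unitary_mat_def)
qed

lemma sqnorm_unitary:
  assumes "unitary_mat n U" "v \<in> carrier_vec n"
  shows "sqnorm (U *\<^sub>v v) = sqnorm v"
  using qform_congruence[of "1\<^sub>m n" n U n v] unitary_matD[OF assms(1)] assms(2)
    qform_one[of v n] qform_one[of "U *\<^sub>v v" n] by simp

text \<open>Eigenvectors are the columns of \<open>U\<close>. The order of \<open>d\<close> is left
  free and its values from \<open>n\<close> on are irrelevant; functional calculus then acts on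
  \<open>d\<close> alone.\<close>

definition spectral :: "nat \<Rightarrow> complex mat \<Rightarrow> (nat \<Rightarrow> real) \<Rightarrow> complex mat" where
  "spectral n U d = U * diag_of n d * mat_adjoint U"

lemma spectral_carrier [simp]: "unitary_mat n U \<Longrightarrow> spectral n U d \<in> carrier_mat n n"
  using unitary_matD[of n U] by (auto simp: spectral_def intro!: mult_carrier_mat[of _ n n])

lemma spectral_cong: "(\<And>i. i < n \<Longrightarrow> d i = e i) \<Longrightarrow> spectral n U d = spectral n U e"
  using diag_of_cong[of n d e] by (simp add: spectral_def)

lemma spectral_mult:
  assumes "unitary_mat n U"
  shows "spectral n U d * spectral n U e = spectral n U (\<lambda>i. d i * e i)"
proof -
  note U = unitary_matD[OF assms]
  have "spectral n U d * spectral n U e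
      = U * diag_of n d * ((mat_adjoint U * U) * (diag_of n e * mat_adjoint U))"
    unfolding spectral_def using U(1,2)
    by (simp add: assoc_mult_mat[of _ n n _ n _ n] mult_carrier_mat[of _ n n])
  also have "\<dots> = U * (diag_of n d * diag_of n e) * mat_adjoint U"
    using U by (simp add: assoc_mult_mat[of _ n n _ n _ n] mult_carrier_mat[of _ n n])
  finally show ?thesis by (simp add: diag_of_mult spectral_def)
qed

lemma spectral_one: "unitary_mat n U \<Longrightarrow> spectral n U (\<lambda>_. 1) = 1\<^sub>m n"
  using unitary_matD[of n U] by (simp add: spectral_def diag_of_one)

lemma spectral_adjoint:
  assumes "unitary_mat n U"
  shows "mat_adjoint (spectral n U d) = spectral n U d"
  using unitary_matD[OF assms]
  by (simp add: spectral_def mat_adjoint_mult[of _ n n _ n] assoc_mult_mat[of _ n n _ n _ n]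
      mult_carrier_mat[of _ n n])

lemma hermitian_spectral: "unitary_mat n U \<Longrightarrow> hermitian_mat n (spectral n U d)"
  by (simp add: hermitian_mat_def spectral_adjoint)

text \<open>In the eigenbasis the form integrates the eigenvalues against the spectral measure of
  \<open>v\<close>; its total mass is computed in \<open>sum_spectral_weights\<close>.\<close>

lemma qform_spectral:
  assumes "unitary_mat n U" "v \<in> carrier_vec n"
  shows "qform (spectral n U d) v = (\<Sum>i<n. d i * (cmod ((mat_adjoint U *\<^sub>v v) $ i))\<^sup>2)"
  using qform_congruence[of "diag_of n d" n "mat_adjoint U" n v] unitary_matD[OF assms(1)] assms(2)
    qform_diag[of "mat_adjoint U *\<^sub>v v" n d]
  by (simp add: spectral_def)

lemma sum_spectral_weights:
  assumes "unitary_mat n U" "v \<in> carrier_vec n"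
  shows "(\<Sum>i<n. (cmod ((mat_adjoint U *\<^sub>v v) $ i))\<^sup>2) = sqnorm v"
  using sqnorm_unitary[OF unitary_adjoint[OF assms(1)] assms(2)] unitary_matD[OF assms(1)]
  by (simp add: sqnorm_def)

lemma spectral_smult:
  assumes "unitary_mat n U"
  shows "complex_of_real c \<cdot>\<^sub>m spectral n U d = spectral n U (\<lambda>i. c * d i)"
proof -
  note U = unitary_matD[OF assms]
  have "diag_of n (\<lambda>i. c * d i) = complex_of_real c \<cdot>\<^sub>m diag_of n d"
    by (rule eq_matI) auto
  then show ?thesis using U
    by (simp add: spectral_def mult_smult_distrib[of _ n n _ n] mult_smult_assoc_mat[of _ n n _ n]
        mult_carrier_mat[of _ n n])
qed

section \<open>The spectral theorem\<close>

text \<open>Complete \<open>v\<close> to a basis and orthogonalise: Gram-Schmidt keeps the first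
  vector, and normalising the columns leaves it alone because \<open>v\<close> is a unit
  vector.\<close>

lemma unitary_with_first_column:
  assumes v: "v \<in> carrier_vec n" and v1: "sqnorm v = 1" and n: "n \<noteq> 0"
  shows "\<exists>U. unitary_mat n U \<and> col U 0 = v"
proof -
  have v0: "v \<noteq> 0\<^sub>v n"
    using v1 by (auto simp: sqnorm_def)
  interpret cof_vec_space n "TYPE(complex)" .
  define b where "b = basis_completion v"
  define ws where "ws = gram_schmidt n b"
  from basis_completion[OF v v0, folded b_def]
  have dist_b: "distinct b" and indep: "\<not> lin_dep (set b)" and b: "set b \<subseteq> carrier_vec n"
    and hdb: "hd b = v" and len_b: "length b = n" by auto
  from hdb len_b n obtain vs where bv: "b = v # vs" by (cases b) auto
  from gram_schmidt_result[OF b dist_b indep refl, folded ws_def]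
  have ws: "set ws \<subseteq> carrier_vec n" "corthogonal ws" "length ws = n"
    by (auto simp: len_b)
  have "hd ws = v"
    using gram_schmidt_hd[OF v, of vs, folded bv] by (simp add: ws_def)
  then have ws0: "ws ! 0 = v"
    using ws(3) n by (cases ws) auto
  \<comment> \<open>Gram-Schmidt gives orthogonal vectors only; dividing by their lengths makes them
    orthonormal.\<close>
  define c where "c j = sqrt (sqnorm (ws ! j))" for j
  define U where "U = mat n n (\<lambda>(i, j). ws ! j $ i / c j)"
  have wsc: "ws ! j \<in> carrier_vec n" if "j < n" for j
    using ws that by auto
  have sprod: "ws ! j \<bullet>c ws ! i = (\<Sum>l<n. ws ! j $ l * cnj (ws ! i $ l))" if "i < n" "j < n" for i j
    using wsc[OF that(1)] wsc[OF that(2)] that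
    by (simp add: scalar_prod_def conjugate_complex_def lessThan_atLeast0)
  have self: "ws ! j \<bullet>c ws ! j = sqnorm (ws ! j)" if "j < n" for j
    using sprod[OF that that] wsc[OF that] by (simp add: sqnorm_def complex_norm_square del: of_real_power)
  have "ws ! j \<bullet>c ws ! j \<noteq> 0" if "j < n" for j
    using corthogonalD[OF ws(2), of j j] that ws(3) by simp
  then have c: "c j \<noteq> 0" "(c j)\<^sup>2 = sqnorm (ws ! j)" if "j < n" for j
    using that self sqnorm_nonneg[of "ws ! j"] by (auto simp: c_def)
  have "(mat_adjoint U * U) $$ (i, j) = 1\<^sub>m n $$ (i, j)" if ij: "i < n" "j < n" for i j
  proof -
    have "(mat_adjoint U * U) $$ (i, j) = (\<Sum>l<n. ws ! j $ l * cnj (ws ! i $ l)) / (c i * c j)"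
      using ij by (simp add: U_def scalar_prod_def lessThan_atLeast0 sum_divide_distrib mult_ac)
    also have "\<dots> = (ws ! j \<bullet>c ws ! i) / (c i * c j)"
      using sprod[OF ij] by simp
    also have "\<dots> = (if i = j then 1 else 0)"
    proof (cases "i = j")
      case True
      then show ?thesis
        using c[OF ij(1)] self[OF ij(1)]
        by (simp flip: of_real_mult add: power2_eq_square) (metis mult_eq_0_iff)
    next
      case False
      then show ?thesis
        using corthogonalD[OF ws(2), of j i] ij ws(3) by simp
    qed
    finally show ?thesis using ij by simp
  qed
  then have "mat_adjoint U * U = 1\<^sub>m n"
    by (intro eq_matI) (auto simp: U_def)
  then have "unitary_mat n U"
    by (simp add: unitary_mat_def U_def)
  moreover have "col U 0 = v"
    using n v ws0 v1 by (intro eq_vecI) (auto simp: U_def c_def)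
  ultimately show ?thesis by blast
qed

lemma complex_mat_unit_eigenvector:
  fixes A :: "complex mat"
  assumes A: "A \<in> carrier_mat n n" and n: "n \<noteq> 0"
  obtains e v where "v \<in> carrier_vec n" "sqnorm v = 1" "A *\<^sub>v v = e \<cdot>\<^sub>v v"
proof -
  obtain e where "eigenvalue A e"
    using spectrum_non_empty[OF A] n by (auto simp: spectrum_def)
  then obtain w where w: "w \<in> carrier_vec n" "w \<noteq> 0\<^sub>v n" "A *\<^sub>v w = e \<cdot>\<^sub>v w"
    using A by (auto simp: eigenvalue_def eigenvector_def)
  define c where "c = complex_of_real (1 / sqrt (sqnorm w))"
  have pos: "0 < sqnorm w" using sqnorm_pos[OF w(1,2)] .
  show thesis
  proof
    show "c \<cdot>\<^sub>v w \<in> carrier_vec n" using w by simp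
    show "sqnorm (c \<cdot>\<^sub>v w) = 1"
      using pos by (simp add: sqnorm_smult c_def norm_divide power_divide)
    show "A *\<^sub>v (c \<cdot>\<^sub>v w) = e \<cdot>\<^sub>v (c \<cdot>\<^sub>v w)"
      using w A by (simp add: mult_mat_vec[of _ n n] smult_smult_assoc mult.commute)
  qed
qed

lemma hermitian_congruence:
  assumes "hermitian_mat n A" "P \<in> carrier_mat n m"
  shows "hermitian_mat m (mat_adjoint P * A * P)"
proof -
  have A: "A \<in> carrier_mat n n" "mat_adjoint A = A" and P': "mat_adjoint P \<in> carrier_mat m n"
    using assms by (auto simp: hermitian_mat_def)
  have "mat_adjoint (mat_adjoint P * A * P) = mat_adjoint P * (mat_adjoint A * P)"
    using A P' assms(2)
    by (simp add: mat_adjoint_mult[of _ m n _ m] mat_adjoint_mult[of _ m n _ n] mult_carrier_mat[of _ m n])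
  also have "\<dots> = mat_adjoint P * A * P"
    using A P' assms(2) by (simp add: assoc_mult_mat[of _ m n _ n _ m])
  finally show ?thesis
    unfolding hermitian_mat_def using A P' assms(2) by (blast intro: mult_carrier_mat)
qed

text \<open>Deflation: conjugating by a unitary matrix whose first column is a unit eigenvector
  clears the first column below the diagonal, Hermitian symmetry clears the first row, and induction
  treats the remaining block.\<close>

lemma spectral_decomposition_ex:
  assumes "hermitian_mat n A"
  shows "\<exists>U d. unitary_mat n U \<and> A = spectral n U d"
  using assms
proof (induction n arbitrary: A)
  case 0
  then show ?case
    by (intro exI[of _ "1\<^sub>m 0"] exI[of _ "\<lambda>_. 0"])
      (auto simp: unitary_mat_def hermitian_mat_def spectral_def intro!: eq_matI)
next
  case (Suc n A)
  let ?N = "Suc n"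
  have A: "A \<in> carrier_mat ?N ?N"
    using Suc.prems by (simp add: hermitian_mat_def)
  obtain e v where v: "v \<in> carrier_vec ?N" "sqnorm v = 1" "A *\<^sub>v v = e \<cdot>\<^sub>v v"
    using complex_mat_unit_eigenvector[OF A] by blast
  obtain U where U: "unitary_mat ?N U" and U0: "col U 0 = v"
    using unitary_with_first_column[OF v(1,2)] by blast
  note Uc = unitary_matD[OF U]
  define B where "B = mat_adjoint U * A * U"
  have B: "B \<in> carrier_mat ?N ?N"
    using Uc A by (simp add: B_def mult_carrier_mat[of _ ?N ?N])
  have hB: "hermitian_mat ?N B"
    unfolding B_def by (rule hermitian_congruence[OF Suc.prems Uc(1)])
  then have cnj_B: "cnj (B $$ (j, i)) = B $$ (i, j)" if "i < ?N" "j < ?N" for i j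
    using that mat_adjoint_index[of i B j] B by (auto simp: hermitian_mat_def)
  have "col B 0 = mat_adjoint U * A *\<^sub>v v"
    using U0 Uc A by (simp add: B_def col_mult2[of _ ?N ?N _ ?N] mult_carrier_mat[of _ ?N ?N])
  also have "\<dots> = mat_adjoint U *\<^sub>v (A *\<^sub>v v)"
    using Uc A v by (intro assoc_mult_mat_vec[of _ ?N ?N _ ?N]) auto
  also have "\<dots> = e \<cdot>\<^sub>v (mat_adjoint U *\<^sub>v col U 0)"
    using v Uc U0 by (simp add: mult_mat_vec[of _ ?N ?N])
  also have "mat_adjoint U *\<^sub>v col U 0 = col (mat_adjoint U * U) 0"
    using Uc(1,2) by (simp add: col_mult2[of _ ?N ?N _ ?N])
  finally have colB: "col B 0 = e \<cdot>\<^sub>v col (1\<^sub>m ?N) 0"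
    using Uc by simp
  have Bi0: "B $$ (i, 0) = (if i = 0 then e else 0)" if "i < ?N" for i
    using arg_cong[OF colB, of "\<lambda>x. x $ i"] that B by simp
  have B0i: "B $$ (0, i) = (if i = 0 then e else 0)" if "i < ?N" for i
    using Bi0[OF that] cnj_B[OF that, of 0] cnj_B[of 0 i] Bi0[of 0] that by (auto split: if_splits)
  \<comment> \<open>A diagonal entry of a Hermitian matrix is real, so the eigenvalue can be listed
    in a real-valued \<open>d'\<close>.\<close>
  have e: "complex_of_real (Re e) = e"
    using cnj_B[of 0 0] Bi0[of 0] by (simp add: complex_eq_iff)
  define B' where "B' = mat n n (\<lambda>(i, j). B $$ (Suc i, Suc j))"
  have "hermitian_mat n B'"
    using cnj_B by (auto simp: hermitian_mat_def B'_def intro!: eq_matI)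
  from Suc.IH[OF this] obtain V d where V: "unitary_mat n V" and B'd: "B' = spectral n V d"
    by blast
  note Vc = unitary_matD[OF V]
  define E where "E = mat 1 1 (\<lambda>_. e)"
  have E: "E \<in> carrier_mat 1 1" by (simp add: E_def)
  let ?blk = "\<lambda>X Y. four_block_mat X (0\<^sub>m 1 n) (0\<^sub>m n 1) Y"
  have blk_mult: "?blk X Y * ?blk X' Y' = ?blk (X * X') (Y * Y')"
    if "X \<in> carrier_mat 1 1" "Y \<in> carrier_mat n n" "X' \<in> carrier_mat 1 1" "Y' \<in> carrier_mat n n"
    for X Y X' Y' :: "complex mat"
    using that by (simp add: mult_four_block_mat[of _ 1 1 _ n _ n _ _ 1 _ n])
  define F where "F = ?blk (1\<^sub>m 1) V"
  have F: "F \<in> carrier_mat ?N ?N"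
    using Vc by (auto simp: F_def)
  have F': "mat_adjoint F = ?blk (1\<^sub>m 1) (mat_adjoint V)"
    using Vc by (intro eq_matI) (auto simp: F_def)
  have "mat_adjoint F * F = ?blk (1\<^sub>m 1) (1\<^sub>m n)"
    unfolding F' unfolding F_def using Vc by (simp add: blk_mult del: One_nat_def)
  then have unF: "unitary_mat ?N F"
    using F by (simp add: unitary_mat_def)
  \<comment> \<open>Puts the split-off eigenvalue at index 0 and shifts the others by one.\<close>
  define d' where "d' = case_nat (Re e) d"
  have D: "diag_of ?N d' = ?blk E (diag_of n d)"
    using e by (intro eq_matI) (auto simp: d'_def E_def split: nat.splits)
  have "spectral ?N F d' = ?blk E B'"
    unfolding spectral_def F' D unfolding F_def B'd spectral_def
    using Vc E by (simp add: blk_mult mult_carrier_mat[of _ n n] del: One_nat_def)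
  also have "\<dots> = B"
    using B Bi0 B0i by (intro eq_matI) (auto simp: E_def B'_def)
  finally have BF: "spectral ?N F d' = B" .
  have UF: "unitary_mat ?N (U * F)"
    by (rule unitary_mult[OF U unF])
  have "spectral ?N (U * F) d' = U * spectral ?N F d' * mat_adjoint U"
    using Uc F unfolding spectral_def
    by (simp add: mat_adjoint_mult[of _ ?N ?N _ ?N] assoc_mult_mat[of _ ?N ?N _ ?N _ ?N]
        mult_carrier_mat[of _ ?N ?N])
  also have "\<dots> = U * (mat_adjoint U * A * U) * mat_adjoint U"
    unfolding BF B_def ..
  also have "\<dots> = (U * mat_adjoint U) * A * (U * mat_adjoint U)"
    using Uc(1,2) A
    by (simp add: assoc_mult_mat[of _ ?N ?N _ ?N _ ?N] mult_carrier_mat[of _ ?N ?N])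
  also have "\<dots> = A"
    using Uc A by simp
  finally show ?case
    using UF by metis
qed

lemma spectral_index:
  assumes "i < n" "j < n" "W \<in> carrier_mat n n"
  shows "spectral n W e $$ (i, j) = (\<Sum>l<n. W $$ (i, l) * e l * cnj (W $$ (j, l)))"
proof -
  have "spectral n W e $$ (i, j)
      = (\<Sum>l<n. (W * diag_of n e) $$ (i, l) * mat_adjoint W $$ (l, j))"
    unfolding spectral_def using assms
    by (subst index_mult_mat(1)) (auto simp: scalar_prod_def lessThan_atLeast0)
  then show ?thesis
    using assms by (simp add: mult_diag_of_index[of W n] del: index_mult_mat(1))
qed

text \<open>Each entry is a sum over eigenpairs, and permuting columns and eigenvalues together only
  reorders that sum.\<close>

lemma spectral_permute:
  assumes U: "unitary_mat n U" and p: "p permutes {..<n}"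
  shows "\<exists>V. unitary_mat n V \<and> spectral n U d = spectral n V (d \<circ> p)"
proof -
  note Uc = unitary_matD[OF U]
  define V where "V = mat n n (\<lambda>(i, j). U $$ (i, p j))"
  have pl: "p i < n" if "i < n" for i
    using permutes_in_image[OF p, of i] that by simp
  have V: "V \<in> carrier_mat n n" by (simp add: V_def)
  have "(mat_adjoint V * V) $$ (i, j) = 1\<^sub>m n $$ (i, j)" if "i < n" "j < n" for i j
  proof -
    have "(mat_adjoint V * V) $$ (i, j) = (mat_adjoint U * U) $$ (p i, p j)"
      using that pl Uc(1) by (simp add: V_def scalar_prod_def)
    also have "\<dots> = (if p i = p j then 1 else 0)"
      using that pl Uc by simp
    also have "\<dots> = (if i = j then 1 else 0)"
      using permutes_inj[OF p] by (simp add: inj_eq)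
    finally show ?thesis using that by simp
  qed
  then have "mat_adjoint V * V = 1\<^sub>m n"
    using V by (intro eq_matI) auto
  then have "unitary_mat n V"
    using V by (simp add: unitary_mat_def)
  have "spectral n U d = spectral n V (d \<circ> p)"
  proof (rule eq_matI)
    fix i j assume "i < dim_row (spectral n V (d \<circ> p))" "j < dim_col (spectral n V (d \<circ> p))"
    then have ij: "i < n" "j < n" using V by (auto simp: spectral_def)
    have "spectral n U d $$ (i, j) = (\<Sum>l<n. U $$ (i, p l) * d (p l) * cnj (U $$ (j, p l)))"
      unfolding spectral_index[OF ij Uc(1)]
      by (rule sum.permute[OF p, unfolded comp_def])
    also have "\<dots> = spectral n V (d \<circ> p) $$ (i, j)"
      unfolding spectral_index[OF ij V] using ij by (intro sum.cong) (auto simp: V_def)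
    finally show "spectral n U d $$ (i, j) = spectral n V (d \<circ> p) $$ (i, j)" .
  qed (use V Uc in \<open>auto simp: spectral_def\<close>)
  with \<open>unitary_mat n V\<close> show ?thesis by blast
qed

text \<open>The decreasing order matches the convention of \<open>eig_list\<close>, so that
  \<open>eig\<close> can be read off.\<close>

theorem spectral_decomposition:
  assumes "hermitian_mat n A"
  obtains U d where "unitary_mat n U" "A = spectral n U d"
    "\<And>i j. i \<le> j \<Longrightarrow> j < n \<Longrightarrow> d j \<le> d i"
proof -
  obtain U d where U: "unitary_mat n U" "A = spectral n U d"
    using spectral_decomposition_ex[OF assms] by blast
  let ?xs = "map d [0..<n]"
  let ?ys = "rev (sort ?xs)"
  obtain p where p: "p permutes {..<length ?xs}" "permute_list p ?xs = ?ys"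
    by (rule mset_eq_permutation[of ?ys ?xs]) simp
  have p': "p permutes {..<n}" using p by simp
  have nth: "?ys ! i = d (p i)" if "i < n" for i
    using permute_list_nth[of p ?xs i] p that permutes_in_image[OF p', of i] by simp
  have "sorted_wrt (\<ge>) ?ys"
    by (simp add: sorted_wrt_rev)
  then have "d (p j) \<le> d (p i)" if "i \<le> j" "j < n" for i j
    using sorted_wrt_nth_less[of "(\<ge>)" ?ys i j] nth[of i] nth[of j] that
    by (cases "i = j") auto
  moreover obtain V where "unitary_mat n V" "spectral n U d = spectral n V (d \<circ> p)"
    using spectral_permute[OF U(1) p'] by blast
  ultimately show thesis
    using that[of V "d \<circ> p"] U(2) by auto
qed

section \<open>Eigenvalues and functional calculus\<close>

lemma similar_spectral:
  assumes "unitary_mat n U"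
  shows "similar_mat (spectral n U d) (diag_of n d)"
  using unitary_matD[OF assms] spectral_carrier[OF assms, of d]
  by (intro similar_matI[of _ _ U "mat_adjoint U" n]) (auto simp: spectral_def)

lemma char_poly_spectral:
  assumes "unitary_mat n U"
  shows "char_poly (spectral n U d) = (\<Prod>x \<leftarrow> map d [0..<n]. [:- complex_of_real x, 1:])"
proof -
  have "char_poly (spectral n U d) = char_poly (diag_of n d)"
    by (rule char_poly_similar[OF similar_spectral[OF assms]])
  also have "\<dots> = (\<Prod>a \<leftarrow> diag_mat (diag_of n d). [:- a, 1:])"
    by (rule char_poly_upper_triangular[of _ n]) auto
  also have "diag_mat (diag_of n d) = map complex_of_real (map d [0..<n])"
    by (auto simp: diag_mat_def)
  finally show ?thesis by (simp add: comp_def)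
qed

text \<open>The product determines the multiset of its roots, and a sorted list is determined by its
  multiset. This makes the description operator in \<open>eig_list\<close> meaningful.\<close>

lemma sorted_roots_unique:
  fixes xs ys :: "real list"
  assumes "sorted_wrt (\<ge>) xs" "sorted_wrt (\<ge>) ys"
    and eq: "(\<Prod>x \<leftarrow> xs. [:- complex_of_real x, 1:]) = (\<Prod>x \<leftarrow> ys. [:- complex_of_real x, 1:])"
  shows "xs = ys"
proof -
  have roots: "proots (\<Prod>x \<leftarrow> zs. [:- complex_of_real x, 1:]) = image_mset complex_of_real (mset zs)"
    for zs
  proof (induction zs)
    case (Cons z zs)
    have "(\<Prod>x \<leftarrow> zs. [:- complex_of_real x, 1:]) \<noteq> 0"
      by (auto simp: prod_list_zero_iff)
    then show ?case
      using Cons by (simp add: proots_mult del: mult_pCons_left)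
  qed simp
  have "image_mset complex_of_real (mset xs) = image_mset complex_of_real (mset ys)"
    using eq by (simp flip: roots)
  then have "mset xs = mset ys"
    by (rule injD[OF multiset.inj_map, rotated]) (simp add: inj_on_def)
  then have "mset (rev xs) = mset (rev ys)" by simp
  moreover have "sorted (rev xs)" "sorted (rev ys)"
    using assms(1,2) by (simp_all add: sorted_wrt_rev)
  ultimately have "rev xs = rev ys"
    by (metis properties_for_sort)
  then show ?thesis by simp
qed

text \<open>Eigenvalues are numbered from 1 and \<open>d\<close> from 0, hence
  \<open>k - 1\<close>.\<close>

lemma eig_spectral:
  assumes U: "unitary_mat n U" and d: "\<And>i j. i \<le> j \<Longrightarrow> j < n \<Longrightarrow> d j \<le> d i"
    and k: "k \<in> {1..n}"
  shows "eig n (spectral n U d) k = d (k - 1)"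
proof -
  have srt: "sorted_wrt (\<ge>) (map d [0..<n])"
    using d by (auto simp: sorted_wrt_iff_nth_less)
  have "eig_list n (spectral n U d) = map d [0..<n]"
    unfolding eig_list_def
  proof (rule the_equality)
    fix xs assume "length xs = n \<and> sorted_wrt (\<ge>) xs \<and>
      char_poly (spectral n U d) = (\<Prod>x \<leftarrow> xs. [:- complex_of_real x, 1:])"
    then show "xs = map d [0..<n]"
      using sorted_roots_unique[OF _ srt] char_poly_spectral[OF U, of d] by metis
  qed (use srt char_poly_spectral[OF U, of d] in simp)
  moreover have "k - 1 < n" using k by auto
  ultimately show ?thesis by (simp add: eig_def)
qed

section \<open>Functional calculus: powers and exponentials\<close>

text \<open>The change of basis \<open>W\<close> intertwines the two diagonal matrices, so
  \<open>W $$ (i, j)\<close> vanishes unless \<open>d j = e i\<close>; hence it also intertwines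
  their images under any \<open>f\<close>. The uniqueness required in \<open>mat_powr\<close>
  follows.\<close>

lemma spectral_fun_unique:
  assumes U: "unitary_mat n U" and V: "unitary_mat n V"
    and eq: "spectral n U d = spectral n V e"
  shows "spectral n U (\<lambda>i. f (d i)) = spectral n V (\<lambda>i. f (e i))"
proof -
  note Uc = unitary_matD[OF U] and Vc = unitary_matD[OF V]
  define W where "W = mat_adjoint V * U"
  have W: "W \<in> carrier_mat n n" using Uc Vc by (simp add: W_def mult_carrier_mat[of _ n n])
  note as = assoc_mult_mat[of _ n n _ n _ n] mult_carrier_mat[of _ n n _ n]
  have *: "mat_adjoint V * spectral n U x * U = W * diag_of n x"
    "mat_adjoint V * spectral n V x * U = diag_of n x * W" for x
  proof -
    have "mat_adjoint V * spectral n U x * U = mat_adjoint V * (U * (diag_of n x * (mat_adjoint U * U)))"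
      unfolding spectral_def using Uc(1,2) Vc(1,2) by (simp add: as)
    then show "mat_adjoint V * spectral n U x * U = W * diag_of n x"
      using Uc Vc by (simp add: as W_def)
    have "mat_adjoint V * spectral n V x * U = (mat_adjoint V * V) * (diag_of n x * (mat_adjoint V * U))"
      unfolding spectral_def using Uc(1,2) Vc(1,2) by (simp add: as)
    then show "mat_adjoint V * spectral n V x * U = diag_of n x * W"
      using Uc Vc by (simp add: as W_def)
  qed
  have inter: "W * diag_of n d = diag_of n e * W"
    using *(1)[of d] *(2)[of e] eq by simp
  have "W * diag_of n (\<lambda>i. f (d i)) = diag_of n (\<lambda>i. f (e i)) * W"
  proof (rule eq_matI)
    fix i j assume "i < dim_row (diag_of n (\<lambda>i. f (e i)) * W)" "j < dim_col (diag_of n (\<lambda>i. f (e i)) * W)"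
    then have ij: "i < n" "j < n" using W by auto
    from arg_cong[OF inter, of "\<lambda>X. X $$ (i, j)"]
    have "W $$ (i, j) * d j = e i * W $$ (i, j)"
      using ij W by (simp add: mult_diag_of_index[of W n] diag_of_mult_index[of W n n] del: index_mult_mat(1))
    then have "W $$ (i, j) = 0 \<or> d j = e i" by simp
    then show "(W * diag_of n (\<lambda>i. f (d i))) $$ (i, j) = (diag_of n (\<lambda>i. f (e i)) * W) $$ (i, j)"
      using ij W by (auto simp: mult_diag_of_index[of W n] diag_of_mult_index[of W n n] simp del: index_mult_mat(1))
  qed (use W in auto)
  then have conj: "mat_adjoint V * spectral n U (\<lambda>i. f (d i)) * U = mat_adjoint V * spectral n V (\<lambda>i. f (e i)) * U"
    by (simp add: *)
  \<comment> \<open>The conjugation by \<open>V\<close> and \<open>U\<close> is invertible, so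
    equality after it gives equality before it.\<close>
  have restore: "V * (mat_adjoint V * X * U) * mat_adjoint U = X" if "X \<in> carrier_mat n n" for X
  proof -
    have "V * (mat_adjoint V * X * U) * mat_adjoint U = (V * mat_adjoint V) * (X * (U * mat_adjoint U))"
      using that Uc(1,2) Vc(1,2) by (simp add: as)
    also have "\<dots> = X" using that Uc Vc by simp
    finally show ?thesis .
  qed
  have "spectral n U (\<lambda>i. f (d i)) = V * (mat_adjoint V * spectral n U (\<lambda>i. f (d i)) * U) * mat_adjoint U"
    by (rule restore[OF spectral_carrier[OF U], symmetric])
  also have "\<dots> = V * (mat_adjoint V * spectral n V (\<lambda>i. f (e i)) * U) * mat_adjoint U"
    by (simp only: conj)
  also have "\<dots> = spectral n V (\<lambda>i. f (e i))"
    by (rule restore[OF spectral_carrier[OF V]])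
  finally show ?thesis .
qed

lemma mat_powr_spectral:
  assumes U: "unitary_mat n U" and d: "\<And>i. i < n \<Longrightarrow> 0 < d i"
  shows "mat_powr n (spectral n U d) t = spectral n U (\<lambda>i. d i powr t)"
  unfolding mat_powr_def
proof (rule the_equality)
  fix B assume "\<exists>V e. unitary_mat n V \<and> (\<forall>i<n. 0 < e i) \<and>
    spectral n U d = V * diag_of n e * mat_adjoint V \<and>
    B = V * diag_of n (\<lambda>i. e i powr t) * mat_adjoint V"
  then obtain V e where V: "unitary_mat n V" "spectral n U d = spectral n V e"
    "B = spectral n V (\<lambda>i. e i powr t)"
    by (auto simp: spectral_def)
  then show "B = spectral n U (\<lambda>i. d i powr t)"
    using spectral_fun_unique[OF U V(1,2), of "\<lambda>x. x powr t"] by simp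
qed (use U d in \<open>auto simp: spectral_def\<close>)

lemma spectral_pow:
  assumes U: "unitary_mat n U"
  shows "spectral n U d ^\<^sub>m k = spectral n U (\<lambda>i. d i ^ k)"
proof (induction k)
  case 0
  then show ?case using spectral_one[OF U] spectral_carrier[OF U, of d] by simp
next
  case (Suc k)
  then show ?case by (simp add: spectral_mult[OF U] mult.commute)
qed

text \<open>Each entry of the power series is a finite linear combination of scalar exponential
  series, so the sum may be taken eigenvalue by eigenvalue.\<close>

lemma mat_exp_spectral:
  assumes U: "unitary_mat n U"
  shows "mat_exp (spectral n U d) = spectral n U (\<lambda>i. exp (d i))"
proof (rule eq_matI)
  fix i j assume "i < dim_row (spectral n U (\<lambda>i. exp (d i)))" "j < dim_col (spectral n U (\<lambda>i. exp (d i)))"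
  then have ij: "i < n" "j < n" using unitary_matD[OF U] by (auto simp: spectral_def)
  note Uc = unitary_matD(1)[OF U]
  have "(\<lambda>k. complex_of_real (d l ^ k / fact k)) sums complex_of_real (exp (d l))" for l
    using exp_converges[of "d l"] by (intro sums_of_real) (simp add: divide_inverse mult.commute)
  then have "(\<lambda>k. \<Sum>l<n. U $$ (i, l) * complex_of_real (d l ^ k / fact k) * cnj (U $$ (j, l)))
      sums (\<Sum>l<n. U $$ (i, l) * complex_of_real (exp (d l)) * cnj (U $$ (j, l)))"
    by (intro sums_sum sums_mult sums_mult2)
  moreover have "(\<Sum>l<n. U $$ (i, l) * complex_of_real (d l ^ k / fact k) * cnj (U $$ (j, l)))
      = (spectral n U d ^\<^sub>m k) $$ (i, j) / of_nat (fact k)" for k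
    by (simp add: spectral_pow[OF U] spectral_index[OF ij Uc] sum_divide_distrib)
  ultimately have "(\<Sum>k. (spectral n U d ^\<^sub>m k) $$ (i, j) / of_nat (fact k))
      = (\<Sum>l<n. U $$ (i, l) * complex_of_real (exp (d l)) * cnj (U $$ (j, l)))"
    by (simp add: sums_iff)
  then show "mat_exp (spectral n U d) $$ (i, j) = spectral n U (\<lambda>i. exp (d i)) $$ (i, j)"
    using ij spectral_carrier[OF U, of d] by (simp add: mat_exp_def spectral_index[OF ij Uc])
qed (use unitary_matD[OF U] in \<open>auto simp: mat_exp_def spectral_def\<close>)

section \<open>Comparison of ordered eigenvalues through quadratic forms\<close>

text \<open>There are \<open>k\<close> equations in the first \<open>k + 1\<close> unknowns. A zero
  row makes the system square with determinant zero, and the solution is padded with zeros.\<close>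

lemma homogeneous_system_nontrivial:
  fixes W :: "complex mat"
  assumes k: "k < n"
  obtains a where "a \<in> carrier_vec n" "a \<noteq> 0\<^sub>v n" "\<And>i. k < i \<Longrightarrow> i < n \<Longrightarrow> a $ i = 0"
    "\<And>i. i < k \<Longrightarrow> (\<Sum>j<n. W $$ (i, j) * a $ j) = 0"
proof -
  define C where "C = mat (Suc k) (Suc k) (\<lambda>(i, j). if i = k then 0 else W $$ (i, j))"
  have C: "C \<in> carrier_mat (Suc k) (Suc k)" by (simp add: C_def)
  have "C = mat\<^sub>r (Suc k) (Suc k) (\<lambda>i. if i = k then 0\<^sub>v (Suc k) else vec (Suc k) (\<lambda>j. W $$ (i, j)))"
    by (rule eq_matI) (auto simp: C_def)
  then have "det C = 0"
    using det_row_0[of k "Suc k" "\<lambda>i. vec (Suc k) (\<lambda>j. W $$ (i, j))"] by simp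
  then obtain b where b: "b \<in> carrier_vec (Suc k)" "b \<noteq> 0\<^sub>v (Suc k)" "C *\<^sub>v b = 0\<^sub>v (Suc k)"
    using det_0_iff_vec_prod_zero_field[OF C] by blast
  define a where "a = vec n (\<lambda>i. if i \<le> k then b $ i else 0)"
  show thesis
  proof
    show "a \<in> carrier_vec n" by (simp add: a_def)
    from b obtain i where i: "i < Suc k" "b $ i \<noteq> 0"
      by (metis carrier_vecD eq_vecI index_zero_vec)
    then have "a $ i \<noteq> 0" using k by (simp add: a_def)
    then show "a \<noteq> 0\<^sub>v n" using i k by auto
    show "a $ i = 0" if "k < i" "i < n" for i using that by (simp add: a_def)
    show "(\<Sum>j<n. W $$ (i, j) * a $ j) = 0" if "i < k" for i
    proof -
      have "(\<Sum>j<n. W $$ (i, j) * a $ j) = (\<Sum>j<Suc k. W $$ (i, j) * b $ j)"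
        using k by (intro sum.mono_neutral_cong_right) (auto simp: a_def)
      also have "\<dots> = (C *\<^sub>v b) $ i"
        using that b(1) by (auto simp: C_def scalar_prod_def lessThan_atLeast0 intro!: sum.cong)
      finally show ?thesis using b(3) that by simp
    qed
  qed
qed

text \<open>One half of the Courant--Fischer principle: the span of the first \<open>k + 1\<close> eigenvectors
  of one matrix meets the orthogonal complement of the first \<open>k\<close> eigenvectors of the other.\<close>

lemma spectral_compare:
  assumes U: "unitary_mat n U" and V: "unitary_mat n V"
    and x: "\<And>i j. i \<le> j \<Longrightarrow> j < n \<Longrightarrow> x j \<le> x i"
    and y: "\<And>i j. i \<le> j \<Longrightarrow> j < n \<Longrightarrow> y j \<le> y i"
    and f: "mono f"
    and le: "\<And>v. v \<in> carrier_vec n \<Longrightarrow> sqnorm v = 1 \<Longrightarrow>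
      f (qform (spectral n U x) v) \<le> qform (spectral n V y) v"
    and k: "k < n"
  shows "f (x k) \<le> y k"
proof -
  note Uc = unitary_matD[OF U] and Vc = unitary_matD[OF V]
  \<comment> \<open>\<open>W\<close> turns \<open>U\<close>-coordinates into
    \<open>V\<close>-coordinates, so the equations for \<open>a0\<close> make \<open>v\<close>
    orthogonal to the first \<open>k\<close> columns of \<open>V\<close>.\<close>
  define W where "W = mat_adjoint V * U"
  have W: "W \<in> carrier_mat n n" using Uc Vc by (simp add: W_def mult_carrier_mat[of _ n n])
  obtain a0 where a0: "a0 \<in> carrier_vec n" "a0 \<noteq> 0\<^sub>v n" "\<And>i. k < i \<Longrightarrow> i < n \<Longrightarrow> a0 $ i = 0"
    "\<And>i. i < k \<Longrightarrow> (\<Sum>j<n. W $$ (i, j) * a0 $ j) = 0"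
    using homogeneous_system_nontrivial[OF k, of W] by blast
  define c where "c = complex_of_real (1 / sqrt (sqnorm a0))"
  define a where "a = c \<cdot>\<^sub>v a0"
  have a: "a \<in> carrier_vec n" "\<And>i. k < i \<Longrightarrow> i < n \<Longrightarrow> a $ i = 0"
    using a0 by (auto simp: a_def)
  have a1: "sqnorm a = 1"
    using sqnorm_pos[OF a0(1,2)] by (simp add: a_def sqnorm_smult c_def norm_divide power_divide)
  define v where "v = U *\<^sub>v a"
  have v: "v \<in> carrier_vec n" "sqnorm v = 1"
    using Uc a a1 sqnorm_unitary[OF U a(1)] by (auto simp: v_def)
  have Ua: "mat_adjoint U *\<^sub>v v = a"
  proof -
    have "mat_adjoint U *\<^sub>v v = (mat_adjoint U * U) *\<^sub>v a"
      unfolding v_def using Uc a by (intro assoc_mult_mat_vec[symmetric, of _ n n _ n]) auto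
    then show ?thesis using Uc a by simp
  qed
  have Va: "mat_adjoint V *\<^sub>v v = W *\<^sub>v a"
    unfolding v_def W_def using Uc Vc a by (intro assoc_mult_mat_vec[symmetric, of _ n n _ n]) auto
  have zero: "(mat_adjoint V *\<^sub>v v) $ i = 0" if "i < k" for i
  proof -
    have "(W *\<^sub>v a) $ i = (\<Sum>j<n. W $$ (i, j) * a $ j)"
      using that k W a by (simp add: scalar_prod_def lessThan_atLeast0)
    also have "\<dots> = c * (\<Sum>j<n. W $$ (i, j) * a0 $ j)"
      using a0(1) by (simp add: a_def sum_distrib_left mult_ac)
    finally show ?thesis using a0(4)[OF that] by (simp add: Va)
  qed
  \<comment> \<open>Indices beyond \<open>k\<close>, where \<open>x i\<close> may fall below
    \<open>x k\<close>, carry no weight.\<close>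
  have "x k * (\<Sum>i<n. (cmod (a $ i))\<^sup>2) \<le> (\<Sum>i<n. x i * (cmod (a $ i))\<^sup>2)"
    unfolding sum_distrib_left
  proof (rule sum_mono)
    fix i assume "i \<in> {..<n}"
    then show "x k * (cmod (a $ i))\<^sup>2 \<le> x i * (cmod (a $ i))\<^sup>2"
      using x[of i k] k a(2)[of i] by (cases "i \<le> k") (auto intro!: mult_right_mono)
  qed
  then have "x k \<le> qform (spectral n U x) v"
    using a1 a by (simp add: qform_spectral[OF U v(1)] Ua sqnorm_def)
  then have "f (x k) \<le> f (qform (spectral n U x) v)"
    using f by (simp add: monoD)
  also have "\<dots> \<le> qform (spectral n V y) v"
    by (rule le[OF v])
  \<comment> \<open>Indices below \<open>k\<close>, where \<open>y i\<close> may exceed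
    \<open>y k\<close>, carry no weight.\<close>
  also have "\<dots> \<le> (\<Sum>i<n. y k * (cmod ((mat_adjoint V *\<^sub>v v) $ i))\<^sup>2)"
    unfolding qform_spectral[OF V v(1)]
  proof (rule sum_mono)
    fix i assume "i \<in> {..<n}"
    then show "y i * (cmod ((mat_adjoint V *\<^sub>v v) $ i))\<^sup>2 \<le> y k * (cmod ((mat_adjoint V *\<^sub>v v) $ i))\<^sup>2"
      using y[of k i] zero[of i] by (cases "k \<le> i") (auto intro!: mult_right_mono)
  qed
  also have "\<dots> = y k"
    using sum_spectral_weights[OF V v(1)] v(2) by (simp flip: sum_distrib_left)
  finally show ?thesis .
qed

section \<open>The Kantorovich constant\<close>

text \<open>The tangent at the mean \<open>c\<close> lies below the exponential; averaging its
  values at \<open>a\<close> and \<open>b\<close> cancels the linear part.\<close>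

lemma exp_convex:
  fixes \<alpha> a b :: real
  assumes "0 \<le> \<alpha>" "\<alpha> \<le> 1"
  shows "exp ((1 - \<alpha>) * a + \<alpha> * b) \<le> (1 - \<alpha>) * exp a + \<alpha> * exp b"
proof -
  define c where "c = (1 - \<alpha>) * a + \<alpha> * b"
  have "exp c * (1 + (a - c)) \<le> exp c * exp (a - c)" "exp c * (1 + (b - c)) \<le> exp c * exp (b - c)"
    by simp_all
  then have "exp c * (1 + (a - c)) \<le> exp a" "exp c * (1 + (b - c)) \<le> exp b"
    by (simp_all flip: exp_add)
  then have "(1 - \<alpha>) * (exp c * (1 + (a - c))) + \<alpha> * (exp c * (1 + (b - c)))
      \<le> (1 - \<alpha>) * exp a + \<alpha> * exp b"
    using assms by (intro add_mono mult_left_mono) auto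
  moreover have "(1 - \<alpha>) * (exp c * (1 + (a - c))) + \<alpha> * (exp c * (1 + (b - c))) = exp c"
  proof -
    have "(1 - \<alpha>) * (exp c * (1 + (a - c))) + \<alpha> * (exp c * (1 + (b - c)))
        = exp c * (1 + ((1 - \<alpha>) * a + \<alpha> * b - c))"
      by (simp add: algebra_simps)
    then show ?thesis by (simp add: c_def)
  qed
  ultimately show ?thesis by (simp add: c_def)
qed

text \<open>The weighted arithmetic-geometric mean inequality for 1 and \<open>z\<close>, which is
  convexity of the exponential between 0 and \<open>ln z\<close>.\<close>

lemma powr_le_weighted_mean:
  fixes z \<alpha> :: real
  assumes "0 < z" "0 \<le> \<alpha>" "\<alpha> \<le> 1"
  shows "z powr \<alpha> \<le> 1 - \<alpha> + \<alpha> * z"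
  using exp_convex[OF assms(2,3), of 0 "ln z"] assms(1) by (simp add: powr_def)

text \<open>Concavity of the power: the tangent at \<open>y\<close> dominates the end point values
  at 1 and \<open>w\<close>, and averaging these so that the abscissae give \<open>y\<close> returns
  the value at \<open>y\<close>.\<close>

lemma powr_chord_le:
  fixes w y \<alpha> :: real
  assumes w: "1 < w" and y: "1 \<le> y" "y \<le> w" and \<alpha>: "0 \<le> \<alpha>" "\<alpha> \<le> 1"
  shows "(w - w powr \<alpha>) / (w - 1) + (w powr \<alpha> - 1) / (w - 1) * y \<le> y powr \<alpha>"
proof -
  have tangent: "z powr \<alpha> \<le> y powr \<alpha> * (1 - \<alpha> + \<alpha> * (z / y))" if "0 < z" for z
  proof -
    have "y powr \<alpha> * (z / y) powr \<alpha> \<le> y powr \<alpha> * (1 - \<alpha> + \<alpha> * (z / y))"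
      using powr_le_weighted_mean[OF _ \<alpha>, of "z / y"] that y by (intro mult_left_mono) auto
    then show ?thesis using that y by (simp add: powr_divide)
  qed
  \<comment> \<open>The weight that writes \<open>y\<close> as a mean of 1 and
    \<open>w\<close>.\<close>
  define s where "s = (y - 1) / (w - 1)"
  have s: "0 \<le> s" "s \<le> 1" "1 - s + s * w = y"
  proof -
    show "0 \<le> s" "s \<le> 1" using w y by (simp_all add: s_def)
    have "s * (w - 1) = y - 1" using w by (simp add: s_def)
    then show "1 - s + s * w = y" by (simp add: algebra_simps)
  qed
  have "(1 - s) * 1 powr \<alpha> + s * w powr \<alpha>
      \<le> (1 - s) * (y powr \<alpha> * (1 - \<alpha> + \<alpha> * (1 / y))) + s * (y powr \<alpha> * (1 - \<alpha> + \<alpha> * (w / y)))"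
    using tangent[of 1] tangent[of w] s w by (intro add_mono mult_left_mono) auto
  also have "\<dots> = y powr \<alpha> * (1 - \<alpha> + \<alpha> * ((1 - s + s * w) / y))"
    by (simp add: algebra_simps add_divide_distrib diff_divide_distrib)
  also have "\<dots> = y powr \<alpha>"
    using y by (simp add: s(3))
  finally have "1 - s + s * w powr \<alpha> \<le> y powr \<alpha>" by simp
  moreover have "1 - s + s * w powr \<alpha> = (w - w powr \<alpha>) / (w - 1) + (w powr \<alpha> - 1) / (w - 1) * y"
    using w by (simp add: s_def field_simps)
  ultimately show ?thesis by simp
qed

text \<open>\<open>\<mu>\<close> is the slope and \<open>\<nu>\<close> the intercept of the chord of
  the power function over the interval from 1 to \<open>w\<close>. Both are positive, so logarithms
  and powers of this form are unproblematic.\<close>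

lemma kantorovich_alt:
  fixes w \<alpha> :: real
  assumes "1 < w" "0 < \<alpha>" "\<alpha> < 1"
  defines "\<mu> \<equiv> (w powr \<alpha> - 1) / (w - 1)" and "\<nu> \<equiv> (w - w powr \<alpha>) / (w - 1)"
  shows "0 < \<mu>" "0 < \<nu>" "kantorovich w \<alpha> = \<nu> / (1 - \<alpha>) * ((1 - \<alpha>) / \<alpha> * (\<mu> / \<nu>)) powr \<alpha>"
proof -
  have "1 < w powr \<alpha>" using powr_less_mono[of 0 \<alpha> w] assms(1,2) by simp
  moreover have "w powr \<alpha> < w" using powr_less_mono[of \<alpha> 1 w] assms(1,3) by simp
  ultimately show "0 < \<mu>" "0 < \<nu>" using assms(1) by (simp_all add: \<mu>_def \<nu>_def)
  have "(w powr \<alpha> - w) / ((\<alpha> - 1) * (w - 1)) = \<nu> / (1 - \<alpha>)"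
    using assms(1,3) by (simp add: \<nu>_def divide_simps) (simp add: algebra_simps)
  moreover have "(\<alpha> - 1) / \<alpha> * ((w powr \<alpha> - 1) / (w powr \<alpha> - w)) = (1 - \<alpha>) / \<alpha> * (\<mu> / \<nu>)"
    using assms(1,2) \<open>w powr \<alpha> < w\<close>
    by (simp add: \<mu>_def \<nu>_def divide_simps) (simp add: algebra_simps)
  ultimately show "kantorovich w \<alpha> = \<nu> / (1 - \<alpha>) * ((1 - \<alpha>) / \<alpha> * (\<mu> / \<nu>)) powr \<alpha>"
    using assms(1,2,3) by (simp add: kantorovich_def)
qed

lemma kantorovich_pos:
  assumes "1 \<le> w" "0 \<le> \<alpha>" "\<alpha> \<le> 1"
  shows "0 < kantorovich w \<alpha>"
proof (cases "w = 1 \<or> \<alpha> = 0 \<or> \<alpha> = 1")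
  case True
  then show ?thesis by (auto simp: kantorovich_def)
next
  case False
  then have *: "1 < w" "0 < \<alpha>" "\<alpha> < 1" using assms by auto
  note pos = kantorovich_alt(1,2)[OF *]
  define r where "r = (1 - \<alpha>) / \<alpha> * ((w powr \<alpha> - 1) / (w - 1) / ((w - w powr \<alpha>) / (w - 1)))"
  have "0 < r" unfolding r_def using * by (intro mult_pos_pos divide_pos_pos[of _ \<alpha>] divide_pos_pos[OF pos]) auto
  then have "0 < (w - w powr \<alpha>) / (w - 1) / (1 - \<alpha>) * r powr \<alpha>"
    using pos(2) * by (intro mult_pos_pos divide_pos_pos[of _ "1 - \<alpha>"]) auto
  then show ?thesis unfolding kantorovich_alt(3)[OF *] r_def .
qed

text \<open>The chord of \<open>x powr \<alpha>\<close> over an interval of ratio \<open>w\<close> is \<open>K(w,\<alpha>)\<close> times a tangent;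
  \<open>t\<close> is the point of tangency.\<close>

lemma kantorovich_tangent:
  assumes h: "1 \<le> h" and \<alpha>: "0 \<le> \<alpha>" "\<alpha> \<le> 1"
  shows "\<exists>t>0. \<forall>x. 1 / h \<le> x \<longrightarrow> x \<le> h \<longrightarrow>
    kantorovich (h\<^sup>2) \<alpha> * (t powr \<alpha> * (1 - \<alpha> + \<alpha> * (x / t))) \<le> x powr \<alpha>"
proof (cases "h = 1 \<or> \<alpha> = 0 \<or> \<alpha> = 1")
  case True
  then show ?thesis
    using h by (intro exI[of _ 1]) (auto simp: kantorovich_def)
next
  case False
  define w where "w = h\<^sup>2"
  have *: "1 < w" "0 < \<alpha>" "\<alpha> < 1"
    using False assms by (auto simp: w_def one_less_power)
  define \<mu> where "\<mu> = (w powr \<alpha> - 1) / (w - 1)"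
  define \<nu> where "\<nu> = (w - w powr \<alpha>) / (w - 1)"
  note K = kantorovich_alt[OF *, folded \<mu>_def \<nu>_def]
  \<comment> \<open>Chosen so that the tangent \<open>1 - \<alpha> + \<alpha> * (x / t)\<close> has
    the same ratio of slope to intercept as the chord.\<close>
  define t where "t = \<nu> / \<mu> * (\<alpha> / (1 - \<alpha>))"
  have t: "0 < t" using K * by (simp add: t_def)
  have inv: "(1 - \<alpha>) / \<alpha> * (\<mu> / \<nu>) = 1 / t"
    using K * by (simp add: t_def field_simps)
  show ?thesis
  \<comment> \<open>Scaling by \<open>h\<close> carries the interval from \<open>1 / h\<close> to
    \<open>h\<close> onto the one from 1 to \<open>w\<close>, which moves the tangency point to
    \<open>t / h\<close>.\<close>
  proof (intro exI[of _ "t / h"] conjI allI impI)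
    show "0 < t / h" using t h by simp
    fix x assume x: "1 / h \<le> x" "x \<le> h"
    have x0: "0 < x" using x h by (smt (verit) divide_pos_pos)
    have "kantorovich w \<alpha> * ((t / h) powr \<alpha> * (1 - \<alpha> + \<alpha> * (x / (t / h))))
        = \<nu> / (1 - \<alpha>) * (1 / h powr \<alpha>) * (1 - \<alpha> + \<alpha> * (x * h / t))"
      unfolding K(3) inv using t h by (simp add: powr_divide)
    also have "\<dots> = (\<nu> + \<nu> * (\<alpha> / (1 - \<alpha>)) / t * (x * h)) / h powr \<alpha>"
      using * t h by (simp add: divide_simps) (simp add: algebra_simps)
    also have "\<nu> * (\<alpha> / (1 - \<alpha>)) / t = \<mu>"
      using K * by (simp add: t_def)
    also have "(\<nu> + \<mu> * (x * h)) / h powr \<alpha> \<le> (x * h) powr \<alpha> / h powr \<alpha>"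
    proof (rule divide_right_mono)
      have "1 \<le> x * h" using x(1) h by (simp add: field_simps)
      moreover have "x * h \<le> w" using x(2) h by (simp add: w_def power2_eq_square)
      ultimately show "\<nu> + \<mu> * (x * h) \<le> (x * h) powr \<alpha>"
        unfolding \<mu>_def \<nu>_def by (intro powr_chord_le * \<alpha>)
    qed simp
    also have "\<dots> = x powr \<alpha>" using x0 h by (simp add: powr_mult)
    finally show "kantorovich (h\<^sup>2) \<alpha> * ((t / h) powr \<alpha> * (1 - \<alpha> + \<alpha> * (x / (t / h)))) \<le> x powr \<alpha>"
      by (simp add: w_def)
  qed
qed

section \<open>The Kantorovich constant for small exponents\<close>

text \<open>The logarithm of the constant equals \<open>p * g p\<close>, where \<open>g\<close> is
  built from an auxiliary function with a limit at 0. The singular logarithms cancel and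
  \<open>g\<close> tends to 0.\<close>

lemma kantorovich_root_tendsto:
  assumes D: "0 \<le> D" and \<alpha>: "0 \<le> \<alpha>" "\<alpha> \<le> 1"
  shows "((\<lambda>p. kantorovich (exp (2 * p * D)) \<alpha> powr (- 1 / p)) \<longlongrightarrow> 1) (at_right 0)"
proof (cases "D = 0 \<or> \<alpha> = 0 \<or> \<alpha> = 1")
  case True
  then show ?thesis by (auto simp: kantorovich_def)
next
  case False
  then have *: "0 < D" "0 < \<alpha>" "\<alpha> < 1" using assms by auto
  \<comment> \<open>The remainder in \<open>ln (exp x - 1) = ln x + x * \<psi> x\<close>, which
    separates the singularity at 0.\<close>
  define \<psi> where "\<psi> x = ln ((exp x - 1) / x) / x" for x :: real
  have "(\<psi> \<longlongrightarrow> 1 / 2) (at_right 0)"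
    unfolding \<psi>_def by real_asymp
  then have \<psi>: "((\<lambda>p. \<psi> (c * p)) \<longlongrightarrow> 1 / 2) (at_right 0)" if "0 < c" for c
    by (rule filterlim_compose) (use that in real_asymp)
  define g where "g p = 2 * D * ((1 - \<alpha>) * \<alpha> + (1 - \<alpha>)\<^sup>2 * \<psi> ((1 - \<alpha>) * 2 * D * p)
    + \<alpha>\<^sup>2 * \<psi> (\<alpha> * 2 * D * p) - \<psi> (2 * D * p))" for p
  have "(g \<longlongrightarrow> 2 * D * ((1 - \<alpha>) * \<alpha> + (1 - \<alpha>)\<^sup>2 * (1 / 2) + \<alpha>\<^sup>2 * (1 / 2) - 1 / 2)) (at_right 0)"
    unfolding g_def by (intro tendsto_intros \<psi>) (use * in auto)
  \<comment> \<open>The bracket is half of the square of \<open>(1 - \<alpha>) + \<alpha>\<close>,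
    minus one half.\<close>
  also have "2 * D * ((1 - \<alpha>) * \<alpha> + (1 - \<alpha>)\<^sup>2 * (1 / 2) + \<alpha>\<^sup>2 * (1 / 2) - 1 / 2) = 0"
    by (simp add: field_simps power2_eq_square)
  finally have "((\<lambda>p. exp (- g p)) \<longlongrightarrow> 1) (at_right 0)"
    using tendsto_exp[OF tendsto_minus, of g 0] by simp
  moreover have "\<forall>\<^sub>F p in at_right 0. exp (- g p) = kantorovich (exp (2 * p * D)) \<alpha> powr (- 1 / p)"
    using eventually_at_right_less
  proof eventually_elim
    case (elim p)
    define s where "s = 2 * D * p"
    have s: "0 < s" using elim * by (simp add: s_def)
    define w where "w = exp s"
    have w: "1 < w" using s by (simp add: w_def)
    define \<mu> where "\<mu> = (w powr \<alpha> - 1) / (w - 1)"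
    define \<nu> where "\<nu> = (w - w powr \<alpha>) / (w - 1)"
    note K = kantorovich_alt[OF w *(2,3), folded \<mu>_def \<nu>_def]
    have \<psi>': "ln (exp x - 1) = ln x + x * \<psi> x" if "0 < x" for x
      using that by (simp add: \<psi>_def ln_div)
    have \<mu>: "ln \<mu> = ln (exp (\<alpha> * s) - 1) - ln (exp s - 1)"
      using s * by (simp add: \<mu>_def w_def powr_def ln_div)
    \<comment> \<open>Pulling out \<open>exp (\<alpha> * s)\<close> leaves only differences of the
      form \<open>exp x - 1\<close>, to which \<open>\<psi>'\<close> applies.\<close>
    have "\<nu> = exp (\<alpha> * s) * (exp ((1 - \<alpha>) * s) - 1) / (exp s - 1)"
      by (simp add: \<nu>_def w_def powr_def right_diff_distrib left_diff_distrib flip: exp_add)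
    then have \<nu>: "ln \<nu> = \<alpha> * s + ln (exp ((1 - \<alpha>) * s) - 1) - ln (exp s - 1)"
      using s * by (simp add: ln_div ln_mult)
    have "ln (kantorovich w \<alpha>) = ln \<nu> - ln (1 - \<alpha>) + \<alpha> * (ln (1 - \<alpha>) - ln \<alpha> + (ln \<mu> - ln \<nu>))"
      unfolding K(3) using K(1,2) * by (simp add: ln_mult ln_div ln_powr)
    also have "\<dots> = s * ((1 - \<alpha>) * \<alpha> + (1 - \<alpha>)\<^sup>2 * \<psi> ((1 - \<alpha>) * s) + \<alpha>\<^sup>2 * \<psi> (\<alpha> * s) - \<psi> s)"
    proof -
      have "ln (exp (\<alpha> * s) - 1) = ln \<alpha> + ln s + \<alpha> * s * \<psi> (\<alpha> * s)"
        "ln (exp ((1 - \<alpha>) * s) - 1) = ln (1 - \<alpha>) + ln s + (1 - \<alpha>) * s * \<psi> ((1 - \<alpha>) * s)"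
        using s * \<psi>'[of "\<alpha> * s"] \<psi>'[of "(1 - \<alpha>) * s"] by (simp_all add: ln_mult)
      \<comment> \<open>The logarithms and values of \<open>\<psi>\<close> become free variables, so
        only a polynomial identity remains; \<open>la\<close>, \<open>lb\<close> and
        \<open>ls\<close> cancel.\<close>
      moreover have "\<alpha> * s + (lb + ls + (1 - \<alpha>) * s * B) - (ls + s * C) - lb
          + \<alpha> * (lb - la + (la + ls + \<alpha> * s * A - (ls + s * C)
            - (\<alpha> * s + (lb + ls + (1 - \<alpha>) * s * B) - (ls + s * C))))
        = s * ((1 - \<alpha>) * \<alpha> + (1 - \<alpha>)\<^sup>2 * B + \<alpha>\<^sup>2 * A - C)" for la lb ls A B C
        by (simp add: algebra_simps power2_eq_square)
      ultimately show ?thesis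
        unfolding \<mu> \<nu> \<psi>'[OF s] by simp
    qed
    also have "\<dots> = p * g p"
      by (simp add: g_def s_def mult_ac)
    finally show ?case
      using elim kantorovich_pos[of w \<alpha>] w *
      by (simp add: powr_def w_def s_def mult_ac)
  qed
  ultimately show ?thesis by (rule Lim_transform_eventually)
qed

section \<open>The geometric mean\<close>

lemma hermitian_add:
  assumes "hermitian_mat n A" "hermitian_mat n B"
  shows "hermitian_mat n (A + B)"
proof -
  have AB: "A \<in> carrier_mat n n" "B \<in> carrier_mat n n" "mat_adjoint A = A" "mat_adjoint B = B"
    using assms by (auto simp: hermitian_mat_def)
  have "mat_adjoint (A + B) = mat_adjoint A + mat_adjoint B"
    using AB(1,2) by (intro eq_matI) auto
  then show ?thesis using AB by (simp add: hermitian_mat_def)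
qed

lemma hermitian_smult:
  assumes "hermitian_mat n A"
  shows "hermitian_mat n (complex_of_real c \<cdot>\<^sub>m A)"
proof -
  have A: "A \<in> carrier_mat n n" "mat_adjoint A = A"
    using assms by (auto simp: hermitian_mat_def)
  have "mat_adjoint (complex_of_real c \<cdot>\<^sub>m A) = complex_of_real c \<cdot>\<^sub>m mat_adjoint A"
    using A(1) by (intro eq_matI) auto
  then show ?thesis using A by (simp add: hermitian_mat_def)
qed

lemma qform_spectral_mono:
  assumes "unitary_mat n U" "v \<in> carrier_vec n" "\<And>i. i < n \<Longrightarrow> d i \<le> e i"
  shows "qform (spectral n U d) v \<le> qform (spectral n U e) v"
  unfolding qform_spectral[OF assms(1,2)]
  by (intro sum_mono mult_right_mono) (use assms(3) in auto)

lemma qform_spectral_affine: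
  assumes "unitary_mat n U" "v \<in> carrier_vec n"
  shows "qform (spectral n U (\<lambda>i. a + b * d i)) v = a * sqnorm v + b * qform (spectral n U d) v"
  by (simp add: qform_spectral[OF assms] sum_spectral_weights[OF assms, symmetric] sum_distrib_left
      distrib_right sum.distrib mult_ac)

lemma qform_spectral_const:
  assumes "unitary_mat n U" "v \<in> carrier_vec n"
  shows "qform (spectral n U (\<lambda>i. a)) v = a * sqnorm v"
  using qform_spectral_affine[OF assms, of a 0] by simp

text \<open>Column \<open>i\<close> of \<open>U\<close> is the witness. It turns bounds on a form
  into bounds on eigenvalues.\<close>

lemma spectral_eigenvalue_qform:
  assumes U: "unitary_mat n U" and i: "i < n"
  shows "\<exists>v \<in> carrier_vec n. sqnorm v = 1 \<and> qform (spectral n U d) v = d i"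
proof
  note Uc = unitary_matD[OF U]
  have "mat_adjoint U *\<^sub>v col U i = col (mat_adjoint U * U) i"
    using Uc(1,2) i by (simp add: col_mult2[of _ n n _ n])
  also have "\<dots> = unit_vec n i" using Uc i by simp
  finally have *: "mat_adjoint U *\<^sub>v col U i = unit_vec n i" .
  show v: "col U i \<in> carrier_vec n" using Uc(1) by auto
  have sum: "(\<Sum>l<n. f l * (cmod (unit_vec n i $ l))\<^sup>2) = f i" for f :: "nat \<Rightarrow> real"
  proof -
    have "(\<Sum>l<n. f l * (cmod (unit_vec n i $ l))\<^sup>2) = (\<Sum>l<n. if l = i then f i else 0)"
      using i by (intro sum.cong) auto
    then show ?thesis using i by simp
  qed
  show "sqnorm (col U i) = 1 \<and> qform (spectral n U d) (col U i) = d i"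
    using sum[of "\<lambda>_. 1"] sum[of d] qform_spectral[OF U v, of d] sum_spectral_weights[OF U v]
    by (simp add: *)
qed

text \<open>Jensen's inequality: the tangent of the exponential at the mean \<open>s\<close> lies
  below it at every eigenvalue, and averaging over the spectral weights gives
  \<open>exp s\<close>.\<close>

lemma exp_qform_le:
  assumes U: "unitary_mat n U" and v: "v \<in> carrier_vec n" "sqnorm v = 1"
  shows "exp (qform (spectral n U d) v) \<le> qform (spectral n U (\<lambda>i. exp (d i))) v"
proof -
  define s where "s = qform (spectral n U d) v"
  have "qform (spectral n U (\<lambda>i. exp s * (1 - s) + exp s * d i)) v
      \<le> qform (spectral n U (\<lambda>i. exp (d i))) v"
  proof (rule qform_spectral_mono[OF U v(1)])
    fix i
    have "exp s * (1 + (d i - s)) \<le> exp s * exp (d i - s)" by simp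
    then show "exp s * (1 - s) + exp s * d i \<le> exp (d i)"
      by (simp add: algebra_simps flip: exp_add)
  qed
  moreover have "qform (spectral n U (\<lambda>i. exp s * (1 - s) + exp s * d i)) v = exp s"
    unfolding qform_spectral_affine[OF U v(1)] v(2) s_def by (simp add: algebra_simps)
  ultimately show ?thesis by (simp add: s_def)
qed

lemma spectral_smult_exp:
  assumes "unitary_mat n U"
  shows "mat_exp (complex_of_real p \<cdot>\<^sub>m spectral n U d) = spectral n U (\<lambda>i. exp (p * d i))"
  using assms by (simp add: spectral_smult mat_exp_spectral)

text \<open>Simultaneous diagonalisation by congruence: \<open>A\<close>, \<open>B\<close> and their geometric mean become
  \<open>1\<close>, \<open>c\<close> and \<open>c powr \<alpha>\<close>, with \<open>c\<close> the eigenvalues of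
  \<open>mat_powr n A (-1/2) * B * mat_powr n A (-1/2)\<close>.\<close>

lemma geo_mean_weights:
  assumes U: "unitary_mat n U" and a: "\<And>i. i < n \<Longrightarrow> lo \<le> a i" "\<And>i. i < n \<Longrightarrow> a i \<le> hi"
    and V: "unitary_mat n V" and b: "\<And>i. i < n \<Longrightarrow> lo \<le> b i" "\<And>i. i < n \<Longrightarrow> b i \<le> hi"
    and lo: "0 < lo" "lo \<le> hi"
  defines "A \<equiv> spectral n U a" and "B \<equiv> spectral n V b"
  shows "hermitian_mat n (geo_mean n \<alpha> A B)"
    and "v \<in> carrier_vec n \<Longrightarrow> \<exists>c w. (\<forall>i<n. lo / hi \<le> c i \<and> c i \<le> hi / lo \<and> 0 \<le> w i) \<and>
      qform A v = (\<Sum>i<n. w i) \<and> qform B v = (\<Sum>i<n. c i * w i) \<and>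
      qform (geo_mean n \<alpha> A B) v = (\<Sum>i<n. c i powr \<alpha> * w i)"
proof -
  have a0: "0 < a i" if "i < n" for i using a(1)[OF that] lo by simp
  define R where "R = spectral n U (\<lambda>i. a i powr (1 / 2))"
  define S where "S = spectral n U (\<lambda>i. a i powr (- 1 / 2))"
  have RS: "mat_powr n A (1 / 2) = R" "mat_powr n A (- 1 / 2) = S"
    unfolding A_def R_def S_def by (simp_all add: mat_powr_spectral[OF U a0])
  have adj: "mat_adjoint R = R" "mat_adjoint S = S"
    by (simp_all add: R_def S_def spectral_adjoint[OF U])
  have car: "R \<in> carrier_mat n n" "S \<in> carrier_mat n n" "B \<in> carrier_mat n n"
    by (simp_all add: R_def S_def B_def U V)
  have pw: "a i powr s * a i powr t = a i powr (s + t)" for i s t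
    by (simp add: powr_add)
  have "R * S = spectral n U (\<lambda>i. 1)"
    unfolding R_def S_def spectral_mult[OF U]
    by (intro spectral_cong) (use a0 in \<open>simp add: pw less_imp_neq[symmetric]\<close>)
  then have RS1: "R * S = 1\<^sub>m n" by (simp add: spectral_one[OF U])
  then have SR1: "S * R = 1\<^sub>m n"
    by (rule mat_mult_left_right_inverse[OF car(1,2)])
  have RR: "R * R = A"
    unfolding R_def A_def spectral_mult[OF U]
    by (intro spectral_cong) (use a0 in \<open>simp add: pw abs_of_pos\<close>)
  have SS: "S * S = spectral n U (\<lambda>i. 1 / a i)"
    unfolding S_def spectral_mult[OF U]
    by (intro spectral_cong) (use a0 in \<open>simp add: pw powr_minus_divide abs_of_pos\<close>)
  have hB: "hermitian_mat n B"
    unfolding B_def by (rule hermitian_spectral[OF V])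
  define C where "C = S * B * S"
  have "hermitian_mat n C"
    using hermitian_congruence[OF hB car(2)] by (simp add: C_def adj)
  then obtain W c where W: "unitary_mat n W" and C: "C = spectral n W c"
    using spectral_decomposition_ex by blast
  \<comment> \<open>At a unit eigenvector \<open>v\<close> of \<open>C\<close> the eigenvalue is the
    form of \<open>B\<close> at \<open>S *\<^sub>v v\<close>, a vector whose squared length lies
    between \<open>1 / hi\<close> and \<open>1 / lo\<close>.\<close>
  have cb: "lo / hi \<le> c i \<and> c i \<le> hi / lo" if i: "i < n" for i
  proof -
    obtain v where v: "v \<in> carrier_vec n" "sqnorm v = 1" "qform C v = c i"
      using spectral_eigenvalue_qform[OF W i, of c] C by auto
    have Sv: "S *\<^sub>v v \<in> carrier_vec n" using car v by auto
    have c1: "c i = qform B (S *\<^sub>v v)"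
      using qform_congruence[OF car(3,2) v(1)] v(3) by (simp add: C_def adj)
    have "qform (mat_adjoint S * 1\<^sub>m n * S) v = qform (1\<^sub>m n) (S *\<^sub>v v)"
      by (rule qform_congruence) (use car v in auto)
    then have "sqnorm (S *\<^sub>v v) = qform (S * S) v"
      using car Sv by (simp add: adj qform_one)
    then have n1: "sqnorm (S *\<^sub>v v) = qform (spectral n U (\<lambda>i. 1 / a i)) v"
      by (simp add: SS)
    have "qform (spectral n U (\<lambda>i. 1 / hi)) v \<le> sqnorm (S *\<^sub>v v)"
      unfolding n1 by (intro qform_spectral_mono U v) (use a a0 lo in \<open>simp add: frac_le\<close>)
    then have l1: "1 / hi \<le> sqnorm (S *\<^sub>v v)"
      by (simp add: qform_spectral_const[OF U v(1)] v(2))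
    have "sqnorm (S *\<^sub>v v) \<le> qform (spectral n U (\<lambda>i. 1 / lo)) v"
      unfolding n1 by (intro qform_spectral_mono U v) (use a a0 lo in \<open>simp add: frac_le\<close>)
    then have u1: "sqnorm (S *\<^sub>v v) \<le> 1 / lo"
      by (simp add: qform_spectral_const[OF U v(1)] v(2))
    have "qform (spectral n V (\<lambda>_. lo)) (S *\<^sub>v v) \<le> qform B (S *\<^sub>v v)"
      "qform B (S *\<^sub>v v) \<le> qform (spectral n V (\<lambda>_. hi)) (S *\<^sub>v v)"
      unfolding B_def by (intro qform_spectral_mono V Sv; use b in simp)+
    then have "lo * sqnorm (S *\<^sub>v v) \<le> c i" "c i \<le> hi * sqnorm (S *\<^sub>v v)"
      by (simp_all add: qform_spectral_const[OF V Sv] c1)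
    moreover have "lo * (1 / hi) \<le> lo * sqnorm (S *\<^sub>v v)" "hi * sqnorm (S *\<^sub>v v) \<le> hi * (1 / lo)"
      using mult_left_mono[OF l1, of lo] mult_left_mono[OF u1, of hi] lo by simp_all
    ultimately show ?thesis by simp
  qed
  have c0: "0 < c i" if "i < n" for i
    using cb[OF that] lo by (smt (verit) divide_pos_pos)
  define F where "F = spectral n W (\<lambda>i. c i powr \<alpha>)"
  have Fc: "F \<in> carrier_mat n n" by (simp add: F_def W)
  have "mat_powr n C \<alpha> = F"
    by (simp add: C F_def mat_powr_spectral[OF W c0])
  then have Z: "geo_mean n \<alpha> A B = R * F * R"
    by (simp only: geo_mean_def RS C_def)
  show "hermitian_mat n (geo_mean n \<alpha> A B)"
    using hermitian_congruence[OF hermitian_spectral[OF W] car(1), of "\<lambda>i. c i powr \<alpha>"]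
    by (simp add: Z F_def adj)
  \<comment> \<open>Thus \<open>A\<close>, \<open>B\<close> and the mean are all of the form
    \<open>R * G * R\<close>, with \<open>G\<close> equal to 1, \<open>C\<close> and
    \<open>F\<close>.\<close>
  have RCR: "R * C * R = B"
  proof -
    have "R * C * R = (R * S) * B * (S * R)"
      unfolding C_def using car
      by (simp add: assoc_mult_mat[of _ n n _ n _ n] mult_carrier_mat[of _ n n _ n])
    then show ?thesis using car by (simp add: RS1 SR1)
  qed
  show "\<exists>c w. (\<forall>i<n. lo / hi \<le> c i \<and> c i \<le> hi / lo \<and> 0 \<le> w i) \<and>
      qform A v = (\<Sum>i<n. w i) \<and> qform B v = (\<Sum>i<n. c i * w i) \<and>
      qform (geo_mean n \<alpha> A B) v = (\<Sum>i<n. c i powr \<alpha> * w i)" if v: "v \<in> carrier_vec n"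
  proof -
    \<comment> \<open>The common weights are the squared coordinates of \<open>u\<close> in the
      eigenbasis \<open>W\<close> of \<open>C\<close>.\<close>
    define u where "u = R *\<^sub>v v"
    have u: "u \<in> carrier_vec n" using car v by (auto simp: u_def)
    have q: "qform (R * G * R) v = qform G u" if "G \<in> carrier_mat n n" for G
      using qform_congruence[OF that car(1) v] by (simp add: adj u_def)
    have "qform A v = sqnorm u"
      using q[of "1\<^sub>m n"] car u by (simp add: RR qform_one)
    moreover have "qform B v = qform (spectral n W c) u"
      using q[OF spectral_carrier[OF W, of c]] RCR by (simp flip: C)
    moreover have "qform (geo_mean n \<alpha> A B) v = qform (spectral n W (\<lambda>i. c i powr \<alpha>)) u"
      using q[OF Fc] by (simp add: Z F_def)
    ultimately show ?thesis
      by (intro exI[of _ c] exI[of _ "\<lambda>i. (cmod ((mat_adjoint W *\<^sub>v u) $ i))\<^sup>2"])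
        (simp add: qform_spectral[OF W u] sum_spectral_weights[OF W u] cb)
  qed
qed

text \<open>A line below the power function on the range of the \<open>c i\<close> can be summed
  against the weights. It is used with the Kantorovich constant times a tangent.\<close>

lemma qform_geo_mean_ge:
  assumes U: "unitary_mat n U" and a: "\<And>i. i < n \<Longrightarrow> lo \<le> a i" "\<And>i. i < n \<Longrightarrow> a i \<le> hi"
    and V: "unitary_mat n V" and b: "\<And>i. i < n \<Longrightarrow> lo \<le> b i" "\<And>i. i < n \<Longrightarrow> b i \<le> hi"
    and lo: "0 < lo" "lo \<le> hi" and v: "v \<in> carrier_vec n"
    and le: "\<And>x. lo / hi \<le> x \<Longrightarrow> x \<le> hi / lo \<Longrightarrow> \<beta> + \<gamma> * x \<le> x powr \<alpha>"
  shows "\<beta> * qform (spectral n U a) v + \<gamma> * qform (spectral n V b) v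
    \<le> qform (geo_mean n \<alpha> (spectral n U a) (spectral n V b)) v"
proof -
  obtain c w where cw: "\<And>i. i < n \<Longrightarrow> lo / hi \<le> c i \<and> c i \<le> hi / lo \<and> 0 \<le> w i"
    and eqs: "qform (spectral n U a) v = (\<Sum>i<n. w i)" "qform (spectral n V b) v = (\<Sum>i<n. c i * w i)"
      "qform (geo_mean n \<alpha> (spectral n U a) (spectral n V b)) v = (\<Sum>i<n. c i powr \<alpha> * w i)"
    using geo_mean_weights(2)[where a = a and b = b and \<alpha> = \<alpha>, OF U a V b lo v] by blast
  have "\<beta> * (\<Sum>i<n. w i) + \<gamma> * (\<Sum>i<n. c i * w i) = (\<Sum>i<n. (\<beta> + \<gamma> * c i) * w i)"
    by (simp only: sum_distrib_left distrib_right sum.distrib mult.assoc)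
  also have "\<dots> \<le> (\<Sum>i<n. c i powr \<alpha> * w i)"
    using cw le by (intro sum_mono mult_right_mono) auto
  finally show ?thesis by (simp add: eqs)
qed

text \<open>The arithmetic-geometric mean inequality applied at each \<open>c i\<close>, then summed
  against the weights.\<close>

lemma qform_geo_mean_le:
  assumes U: "unitary_mat n U" and a: "\<And>i. i < n \<Longrightarrow> lo \<le> a i" "\<And>i. i < n \<Longrightarrow> a i \<le> hi"
    and V: "unitary_mat n V" and b: "\<And>i. i < n \<Longrightarrow> lo \<le> b i" "\<And>i. i < n \<Longrightarrow> b i \<le> hi"
    and lo: "0 < lo" "lo \<le> hi" and v: "v \<in> carrier_vec n" and \<alpha>: "0 \<le> \<alpha>" "\<alpha> \<le> 1"
  shows "qform (geo_mean n \<alpha> (spectral n U a) (spectral n V b)) v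
    \<le> (1 - \<alpha>) * qform (spectral n U a) v + \<alpha> * qform (spectral n V b) v"
proof -
  obtain c w where cw: "\<And>i. i < n \<Longrightarrow> lo / hi \<le> c i \<and> c i \<le> hi / lo \<and> 0 \<le> w i"
    and eqs: "qform (spectral n U a) v = (\<Sum>i<n. w i)" "qform (spectral n V b) v = (\<Sum>i<n. c i * w i)"
      "qform (geo_mean n \<alpha> (spectral n U a) (spectral n V b)) v = (\<Sum>i<n. c i powr \<alpha> * w i)"
    using geo_mean_weights(2)[where a = a and b = b and \<alpha> = \<alpha>, OF U a V b lo v] by blast
  have c0: "0 < c i" if "i < n" for i
    using cw[OF that] lo by (smt (verit) divide_pos_pos)
  have "(\<Sum>i<n. c i powr \<alpha> * w i) \<le> (\<Sum>i<n. (1 - \<alpha> + \<alpha> * c i) * w i)"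
    using c0 cw \<alpha> by (intro sum_mono mult_right_mono powr_le_weighted_mean) auto
  also have "\<dots> = (1 - \<alpha>) * (\<Sum>i<n. w i) + \<alpha> * (\<Sum>i<n. c i * w i)"
    by (simp only: sum_distrib_left distrib_right sum.distrib mult.assoc)
  finally show ?thesis by (simp add: eqs)
qed

section \<open>Eigenvalues of exponentials and spectral bounds\<close>

lemma eig_mat_exp:
  assumes Y: "unitary_mat n Y" "\<And>i j. i \<le> j \<Longrightarrow> j < n \<Longrightarrow> x j \<le> x i" and k: "k \<in> {1..n}"
  shows "eig n (mat_exp (spectral n Y x)) k = exp (x (k - 1))"
  unfolding mat_exp_spectral[OF Y(1)] by (rule eig_spectral) (use Y k in auto)

lemma eig_mat_exp_pos:
  assumes "hermitian_mat n X" "k \<in> {1..n}"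
  shows "0 < eig n (mat_exp X) k"
proof -
  obtain Y x where "unitary_mat n Y" "X = spectral n Y x" "\<And>i j. i \<le> j \<Longrightarrow> j < n \<Longrightarrow> x j \<le> x i"
    using spectral_decomposition[OF assms(1)] by blast
  then show ?thesis using eig_mat_exp[of n Y x k] assms(2) by simp
qed

text \<open>A positive factor preserves the order of the eigenvalues. With \<open>p = 2\<close> it
  passes from the average of \<open>H\<close> and \<open>K\<close> to their sum.\<close>

lemma eig_mat_exp_smult:
  assumes X: "hermitian_mat n X" and k: "k \<in> {1..n}" and p: "0 < p"
  shows "eig n (mat_exp (complex_of_real p \<cdot>\<^sub>m X)) k = eig n (mat_exp X) k powr p"
proof -
  obtain Y x where Y: "unitary_mat n Y" "X = spectral n Y x" "\<And>i j. i \<le> j \<Longrightarrow> j < n \<Longrightarrow> x j \<le> x i"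
    using spectral_decomposition[OF X] by blast
  have "eig n (mat_exp (complex_of_real p \<cdot>\<^sub>m X)) k = exp (p * x (k - 1))"
    unfolding Y(2) spectral_smult[OF Y(1)] by (rule eig_mat_exp) (use Y k p in auto)
  then show ?thesis
    using eig_mat_exp[OF Y(1,3) k] by (simp add: Y(2) powr_def)
qed

text \<open>Divide \<open>exp y * (1 - y) \<le> 1\<close> by \<open>1 - y\<close>; the product of
  the quadratic with \<open>1 - y\<close> is 1 plus the nonnegative term
  \<open>y * y * (1 - 2 * y)\<close>.\<close>

lemma exp_le_quadratic:
  fixes y :: real
  assumes "y \<le> 1 / 2"
  shows "exp y \<le> 1 + y + 2 * y\<^sup>2"
proof -
  have "1 - y \<le> exp (- y)" using exp_ge_add_one_self[of "- y"] by simp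
  then have "exp y * (1 - y) \<le> 1"
    using mult_left_mono[of "1 - y" "exp (- y)" "exp y"] by (simp add: exp_minus)
  also have "1 \<le> (1 + y + 2 * y\<^sup>2) * (1 - y)"
    using assms mult_nonneg_nonneg[of "y\<^sup>2" "1 - 2 * y"] by (simp add: algebra_simps power2_eq_square)
  finally show ?thesis using assms by simp
qed

lemma loewner_spectral_bounds:
  assumes "loewner_le n (complex_of_real m \<cdot>\<^sub>m 1\<^sub>m n) G" "loewner_le n G (complex_of_real M \<cdot>\<^sub>m 1\<^sub>m n)"
  obtains U d where "unitary_mat n U" "G = spectral n U d"
    "\<And>i. i < n \<Longrightarrow> m \<le> d i" "\<And>i. i < n \<Longrightarrow> d i \<le> M"
proof -
  have hG: "hermitian_mat n G" using assms by (simp add: loewner_le_def)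
  then have G: "G \<in> carrier_mat n n" by (simp add: hermitian_mat_def)
  obtain U d where U: "unitary_mat n U" "G = spectral n U d"
    using spectral_decomposition_ex[OF hG] by blast
  have q: "m * sqnorm v \<le> qform G v" "qform G v \<le> M * sqnorm v" if v: "v \<in> carrier_vec n" for v
  proof -
    have "0 \<le> qform (G - complex_of_real m \<cdot>\<^sub>m 1\<^sub>m n) v" "0 \<le> qform (complex_of_real M \<cdot>\<^sub>m 1\<^sub>m n - G) v"
      using assms v by (auto simp: loewner_le_def psd_mat_def qform_def)
    then show "m * sqnorm v \<le> qform G v" "qform G v \<le> M * sqnorm v"
      using G v by (simp_all add: qform_minus[of _ n] qform_smult[of _ n] qform_one)
  qed
  have "m \<le> d i \<and> d i \<le> M" if i: "i < n" for i
  proof -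
    obtain v where "v \<in> carrier_vec n" "sqnorm v = 1" "qform G v = d i"
      using spectral_eigenvalue_qform[OF U(1) i, of d] U(2) by auto
    then show ?thesis using q[of v] by simp
  qed
  then show thesis using that U by blast
qed

section \<open>Lower and upper eigenvalue bounds for the geometric mean of exponentials\<close>

context
  fixes n :: nat and H K :: "complex mat" and m M \<alpha> :: real
  assumes H: "loewner_le n (complex_of_real m \<cdot>\<^sub>m 1\<^sub>m n) H" "loewner_le n H (complex_of_real M \<cdot>\<^sub>m 1\<^sub>m n)"
    and K: "loewner_le n (complex_of_real m \<cdot>\<^sub>m 1\<^sub>m n) K" "loewner_le n K (complex_of_real M \<cdot>\<^sub>m 1\<^sub>m n)"
    and mM: "m \<le> M" and \<alpha>: "0 \<le> \<alpha>" "\<alpha> \<le> 1"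
begin

private abbreviation (input) X where "X \<equiv> complex_of_real (1 - \<alpha>) \<cdot>\<^sub>m H + complex_of_real \<alpha> \<cdot>\<^sub>m K"
private abbreviation (input) Z where "Z p \<equiv> geo_mean n \<alpha> (mat_exp (complex_of_real p \<cdot>\<^sub>m H)) (mat_exp (complex_of_real p \<cdot>\<^sub>m K))"

lemma hermitian_combination: "hermitian_mat n X"
  using H K by (intro hermitian_add hermitian_smult) (auto simp: loewner_le_def)

lemma qform_combination:
  "v \<in> carrier_vec n \<Longrightarrow> qform X v = (1 - \<alpha>) * qform H v + \<alpha> * qform K v"
  using H K by (subst qform_add[of _ n])
    (auto simp: loewner_le_def hermitian_mat_def qform_smult[of _ n] simp del: of_real_diff)

text \<open>The first claim before taking roots. In this form it also yields positivity of the
  eigenvalues of the mean and, for \<open>p = 2\<close> and \<open>\<alpha> = 1 / 2\<close>, the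
  last claim.\<close>

lemma kantorovich_eig_le:
  assumes p: "0 < p" and k: "k \<in> {1..n}"
  shows "kantorovich (exp (2 * p * (M - m))) \<alpha> * eig n (mat_exp X) k powr p \<le> eig n (Z p) k"
proof -
  obtain U h where U: "unitary_mat n U" "H = spectral n U h"
    "\<And>i. i < n \<Longrightarrow> m \<le> h i" "\<And>i. i < n \<Longrightarrow> h i \<le> M"
    using loewner_spectral_bounds[OF H] by blast
  obtain V l where V: "unitary_mat n V" "K = spectral n V l"
    "\<And>i. i < n \<Longrightarrow> m \<le> l i" "\<And>i. i < n \<Longrightarrow> l i \<le> M"
    using loewner_spectral_bounds[OF K] by blast
  let ?lo = "exp (p * m)" and ?hi = "exp (p * M)"
  let ?A = "spectral n U (\<lambda>i. exp (p * h i))" and ?B = "spectral n V (\<lambda>i. exp (p * l i))"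
  \<comment> \<open>The ratio of the spectral bounds: the \<open>c i\<close> of
    \<open>geo_mean_weights\<close> lie between \<open>1 / q\<close> and \<open>q\<close>, end
    points whose ratio \<open>q * q\<close> is the argument of the Kantorovich constant.\<close>
  define q where "q = exp (p * (M - m))"
  have hl: "?hi / ?lo = q" by (simp add: q_def right_diff_distrib flip: exp_diff)
  have q: "1 \<le> q" "q\<^sup>2 = exp (2 * p * (M - m))" "?hi / ?lo = q" "?lo / ?hi = 1 / q"
  proof -
    show "1 \<le> q" "q\<^sup>2 = exp (2 * p * (M - m))"
      using p mM by (simp_all add: q_def mult_ac flip: exp_double)
    have "?lo / ?hi = 1 / (?hi / ?lo)" by simp
    then show "?lo / ?hi = 1 / q" by (simp only: hl)
  qed (rule hl)
  let ?K = "kantorovich (q\<^sup>2) \<alpha>"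
  obtain t where t: "0 < t" and tx: "\<And>x. 1 / q \<le> x \<Longrightarrow> x \<le> q \<Longrightarrow>
      ?K * (t powr \<alpha> * (1 - \<alpha> + \<alpha> * (x / t))) \<le> x powr \<alpha>"
    using kantorovich_tangent[OF q(1) \<alpha>] by blast
  have K0: "0 < ?K" using kantorovich_pos[OF _ \<alpha>, of "q\<^sup>2"] q(1) by simp
  have Z: "Z p = geo_mean n \<alpha> ?A ?B"
    by (simp add: U(2) V(2) spectral_smult_exp[OF U(1)] spectral_smult_exp[OF V(1)])
  have bds: "\<And>i. i < n \<Longrightarrow> ?lo \<le> exp (p * h i)" "\<And>i. i < n \<Longrightarrow> exp (p * h i) \<le> ?hi"
    "\<And>i. i < n \<Longrightarrow> ?lo \<le> exp (p * l i)" "\<And>i. i < n \<Longrightarrow> exp (p * l i) \<le> ?hi" "0 < ?lo" "?lo \<le> ?hi"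
    using U(3,4) V(3,4) p mM by auto
  have hZ: "hermitian_mat n (Z p)"
    unfolding Z by (rule geo_mean_weights(1)[OF U(1) bds(1,2) V(1) bds(3-6)])
  have key: "?K * exp (p * qform X v) \<le> qform (Z p) v" if v: "v \<in> carrier_vec n" "sqnorm v = 1" for v
  proof -
    have J: "exp (p * qform H v) \<le> qform ?A v" "exp (p * qform K v) \<le> qform ?B v"
      using exp_qform_le[OF U(1) v, of "\<lambda>i. p * h i"] exp_qform_le[OF V(1) v, of "\<lambda>i. p * l i"]
        qform_spectral_affine[OF U(1) v(1), of 0 p h] qform_spectral_affine[OF V(1) v(1), of 0 p l]
      by (simp_all add: U(2) V(2))
    \<comment> \<open>Shifting the second exponent by \<open>ln t\<close> before using convexity
      produces exactly the coefficients of the tangent at \<open>t\<close>.\<close>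
    have "exp (p * qform X v) = t powr \<alpha> * exp ((1 - \<alpha>) * (p * qform H v) + \<alpha> * (p * qform K v - ln t))"
      unfolding qform_combination[OF v(1)] using t by (simp add: powr_def algebra_simps flip: exp_add)
    also have "\<dots> \<le> t powr \<alpha> * ((1 - \<alpha>) * exp (p * qform H v) + \<alpha> * exp (p * qform K v - ln t))"
      by (intro mult_left_mono exp_convex \<alpha>) simp
    also have "\<dots> = t powr \<alpha> * ((1 - \<alpha>) * exp (p * qform H v) + \<alpha> * (exp (p * qform K v) / t))"
      using t by (simp add: exp_diff)
    also have "\<dots> \<le> t powr \<alpha> * ((1 - \<alpha>) * qform ?A v + \<alpha> * (qform ?B v / t))"
      using J \<alpha> t by (intro mult_left_mono add_mono divide_right_mono) auto
    finally have "?K * exp (p * qform X v) \<le> ?K * (t powr \<alpha> * ((1 - \<alpha>) * qform ?A v + \<alpha> * (qform ?B v / t)))"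
      using K0 by simp
    also have "\<dots> = (?K * (t powr \<alpha> * (1 - \<alpha>))) * qform ?A v + (?K * (t powr \<alpha> * (\<alpha> / t))) * qform ?B v"
      by (simp add: algebra_simps)
    also have "\<dots> \<le> qform (Z p) v"
      unfolding Z
    proof (rule qform_geo_mean_ge[OF U(1) bds(1,2) V(1) bds(3-6) v(1)])
      fix x assume "?lo / ?hi \<le> x" "x \<le> ?hi / ?lo"
      then show "?K * (t powr \<alpha> * (1 - \<alpha>)) + ?K * (t powr \<alpha> * (\<alpha> / t)) * x \<le> x powr \<alpha>"
        using tx[of x] unfolding q(3,4) by (simp add: algebra_simps)
    qed
    finally show ?thesis .
  qed
  obtain Y x where Y: "unitary_mat n Y" "X = spectral n Y x" "\<And>i j. i \<le> j \<Longrightarrow> j < n \<Longrightarrow> x j \<le> x i"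
    using spectral_decomposition[OF hermitian_combination] by blast
  obtain T z where T: "unitary_mat n T" "Z p = spectral n T z" "\<And>i j. i \<le> j \<Longrightarrow> j < n \<Longrightarrow> z j \<le> z i"
    using spectral_decomposition[OF hZ] by blast
  have "?K * exp (p * x (k - 1)) \<le> z (k - 1)"
    by (rule spectral_compare[OF Y(1) T(1) Y(3) T(3), where f = "\<lambda>s. ?K * exp (p * s)"])
      (use key k K0 p in \<open>auto simp: mono_def simp flip: Y(2) T(2)\<close>)
  moreover have "eig n (Z p) k = z (k - 1)"
    unfolding T(2) by (rule eig_spectral) (use T k in auto)
  moreover have "eig n (mat_exp X) k = exp (x (k - 1))"
    unfolding Y(2) by (rule eig_mat_exp[OF Y(1,3) k])
  ultimately show ?thesis by (simp add: powr_def q(2))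
qed

text \<open>The mean is at most the weighted arithmetic mean of the exponentials, and the quadratic
  bound makes that affine in \<open>X\<close>. The logarithm on the right is the \<open>k\<close>-th
  eigenvalue of \<open>X\<close>.\<close>

lemma eig_geo_mean_le:
  assumes p: "0 < p" and k: "k \<in> {1..n}" and b: "\<bar>m\<bar> \<le> b" "\<bar>M\<bar> \<le> b" "p * b \<le> 1 / 2"
  shows "eig n (Z p) k \<le> 1 + p * ln (eig n (mat_exp X) k) + 2 * (p * b)\<^sup>2"
proof -
  obtain U h where U: "unitary_mat n U" "H = spectral n U h"
    "\<And>i. i < n \<Longrightarrow> m \<le> h i" "\<And>i. i < n \<Longrightarrow> h i \<le> M"
    using loewner_spectral_bounds[OF H] by blast
  obtain V l where V: "unitary_mat n V" "K = spectral n V l"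
    "\<And>i. i < n \<Longrightarrow> m \<le> l i" "\<And>i. i < n \<Longrightarrow> l i \<le> M"
    using loewner_spectral_bounds[OF K] by blast
  let ?lo = "exp (p * m)" and ?hi = "exp (p * M)"
  let ?A = "spectral n U (\<lambda>i. exp (p * h i))" and ?B = "spectral n V (\<lambda>i. exp (p * l i))"
  have Z: "Z p = geo_mean n \<alpha> ?A ?B"
    by (simp add: U(2) V(2) spectral_smult_exp[OF U(1)] spectral_smult_exp[OF V(1)])
  have bds: "\<And>i. i < n \<Longrightarrow> ?lo \<le> exp (p * h i)" "\<And>i. i < n \<Longrightarrow> exp (p * h i) \<le> ?hi"
    "\<And>i. i < n \<Longrightarrow> ?lo \<le> exp (p * l i)" "\<And>i. i < n \<Longrightarrow> exp (p * l i) \<le> ?hi" "0 < ?lo" "?lo \<le> ?hi"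
    using U(3,4) V(3,4) p mM by auto
  have hZ: "hermitian_mat n (Z p)"
    unfolding Z by (rule geo_mean_weights(1)[OF U(1) bds(1,2) V(1) bds(3-6)])
  define c where "c = 2 * (p * b)\<^sup>2"
  have quad: "exp (p * s) \<le> (1 + c) + p * s" if "m \<le> s" "s \<le> M" for s
  proof -
    have "\<bar>p * s\<bar> \<le> p * b" using that b p by (auto simp: abs_mult intro!: mult_left_mono)
    then have "p * s \<le> 1 / 2" "(p * s)\<^sup>2 \<le> (p * b)\<^sup>2"
      using b(3) by (auto simp: abs_le_square_iff[symmetric])
    then show ?thesis using exp_le_quadratic[of "p * s"] by (simp add: c_def)
  qed
  have key: "qform (Z p) v \<le> 1 + c + p * qform X v" if v: "v \<in> carrier_vec n" "sqnorm v = 1" for v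
  proof -
    have "qform (Z p) v \<le> (1 - \<alpha>) * qform ?A v + \<alpha> * qform ?B v"
      unfolding Z by (rule qform_geo_mean_le[OF U(1) bds(1,2) V(1) bds(3-6) v(1) \<alpha>])
    also have "\<dots> \<le> (1 - \<alpha>) * qform (spectral n U (\<lambda>i. (1 + c) + p * h i)) v
        + \<alpha> * qform (spectral n V (\<lambda>i. (1 + c) + p * l i)) v"
      using \<alpha> by (intro add_mono mult_left_mono qform_spectral_mono U(1) V(1) v quad U(3,4) V(3,4)) auto
    also have "\<dots> = 1 + c + p * qform X v"
      unfolding qform_spectral_affine[OF U(1) v(1)] qform_spectral_affine[OF V(1) v(1)]
        qform_combination[OF v(1)] v(2) U(2)[symmetric] V(2)[symmetric]
      by (simp add: algebra_simps)
    finally show ?thesis .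
  qed
  obtain Y x where Y: "unitary_mat n Y" "X = spectral n Y x" "\<And>i j. i \<le> j \<Longrightarrow> j < n \<Longrightarrow> x j \<le> x i"
    using spectral_decomposition[OF hermitian_combination] by blast
  obtain T z where T: "unitary_mat n T" "Z p = spectral n T z" "\<And>i j. i \<le> j \<Longrightarrow> j < n \<Longrightarrow> z j \<le> z i"
    using spectral_decomposition[OF hZ] by blast
  \<comment> \<open>Here the comparison runs from the mean to \<open>X\<close>, so \<open>f\<close>
    is the inverse of the affine map in \<open>key\<close>.\<close>
  have "(z (k - 1) - (1 + c)) / p \<le> x (k - 1)"
  proof (rule spectral_compare[OF T(1) Y(1) T(3) Y(3), where f = "\<lambda>s. (s - (1 + c)) / p"])
    fix v :: "complex vec" assume "v \<in> carrier_vec n" "sqnorm v = 1"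
    from key[OF this] show "(qform (spectral n T z) v - (1 + c)) / p \<le> qform (spectral n Y x) v"
      using p by (simp add: field_simps flip: Y(2) T(2))
  qed (use k p in \<open>auto simp: mono_def divide_right_mono\<close>)
  then have "z (k - 1) \<le> 1 + c + p * x (k - 1)"
    using p by (simp add: field_simps)
  moreover have "eig n (Z p) k = z (k - 1)"
    unfolding T(2) by (rule eig_spectral) (use T k in auto)
  moreover have "eig n (mat_exp X) k = exp (x (k - 1))"
    unfolding Y(2) by (rule eig_mat_exp[OF Y(1,3) k])
  ultimately show ?thesis by (simp add: c_def)
qed

end

section \<open>The constant at \<open>\<alpha> = 1 / 2\<close> and the three claims\<close>

text \<open>With \<open>e = exp D\<close> the argument is the fourth power of \<open>e\<close>, so
  the square root is rational in \<open>e\<close> and the common factor \<open>e * e - 1\<close>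
  cancels.\<close>

lemma kantorovich_half:
  assumes "0 \<le> D"
  shows "kantorovich (exp (4 * D)) (1 / 2) = 2 * exp D / (exp (2 * D) + 1)"
proof (cases "D = 0")
  case True
  then show ?thesis by (simp add: kantorovich_def)
next
  case False
  define e where "e = exp D"
  have e: "1 < e" using False assms by (simp add: e_def)
  have w: "exp (4 * D) = e ^ 4" "(e ^ 4) powr (1 / 2) = e\<^sup>2" "exp (2 * D) = e\<^sup>2"
    by (simp_all add: e_def powr_def flip: exp_of_nat_mult)
  have e2: "1 < e\<^sup>2" "1 < e ^ 4"
    using e by (simp_all add: one_less_power)
  have e4: "e ^ 4 = e\<^sup>2 * e\<^sup>2"
    by (simp add: power2_eq_square power4_eq_xxxx)
  have "(1 / 2 - 1) / (1 / 2) * ((e\<^sup>2 - 1) / (e\<^sup>2 - e ^ 4)) = (1 / e)\<^sup>2"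
  proof -
    have "e\<^sup>2 - e ^ 4 = - (e\<^sup>2 * (e\<^sup>2 - 1))"
      unfolding e4 by (simp only: algebra_simps mult_1_right minus_diff_eq)
    then show ?thesis using e2 by (simp add: power_divide)
  qed
  moreover have "((1 / e)\<^sup>2) powr (1 / 2) = 1 / e"
    using e by (simp add: powr_half_sqrt real_sqrt_divide)
  moreover have "(e\<^sup>2 - e ^ 4) / ((1 / 2 - 1) * (e ^ 4 - 1)) = 2 * e\<^sup>2 / (e\<^sup>2 + 1)"
  proof -
    have "e\<^sup>2 - e ^ 4 = - (e\<^sup>2 * (e\<^sup>2 - 1))" "e ^ 4 - 1 = (e\<^sup>2 + 1) * (e\<^sup>2 - 1)"
      unfolding e4 by (simp_all only: algebra_simps mult_1_right minus_diff_eq)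
    then show ?thesis using e2 by simp
  qed
  moreover have "kantorovich (e ^ 4) (1 / 2) = (e\<^sup>2 - e ^ 4) / ((1 / 2 - 1) * (e ^ 4 - 1)) *
      ((1 / 2 - 1) / (1 / 2) * ((e\<^sup>2 - 1) / (e\<^sup>2 - e ^ 4))) powr (1 / 2)"
    using e2(2) unfolding kantorovich_def w(2) by simp
  ultimately have "kantorovich (exp (4 * D)) (1 / 2) = 2 * e\<^sup>2 / (e\<^sup>2 + 1) * (1 / e)"
    by (simp only: w(1))
  then show ?thesis using e by (simp add: w(3) e_def[symmetric] power2_eq_square)
qed

theorem theorem3p2:
  fixes n :: nat and H K :: "complex mat" and m M \<alpha> :: real
  assumes "hermitian_mat n H" and "hermitian_mat n K"
    and "m \<le> M"
    and "loewner_le n (complex_of_real m \<cdot>\<^sub>m 1\<^sub>m n) H" and "loewner_le n H (complex_of_real M \<cdot>\<^sub>m 1\<^sub>m n)"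
    and "loewner_le n (complex_of_real m \<cdot>\<^sub>m 1\<^sub>m n) K" and "loewner_le n K (complex_of_real M \<cdot>\<^sub>m 1\<^sub>m n)"
    and "0 \<le> \<alpha>" and "\<alpha> \<le> 1"
  shows "(\<forall>p>0. \<forall>k\<in>{1..n}.
            eig n (mat_exp (complex_of_real (1 - \<alpha>) \<cdot>\<^sub>m H + complex_of_real \<alpha> \<cdot>\<^sub>m K)) k
            \<le> kantorovich (exp (2 * p * (M - m))) \<alpha> powr (- 1 / p) *
              eig n (geo_mean n \<alpha> (mat_exp (complex_of_real p \<cdot>\<^sub>m H))
                                 (mat_exp (complex_of_real p \<cdot>\<^sub>m K))) k powr (1 / p))
       \<and> (\<forall>k\<in>{1..n}.
            ((\<lambda>p. kantorovich (exp (2 * p * (M - m))) \<alpha> powr (- 1 / p) *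
                  eig n (geo_mean n \<alpha> (mat_exp (complex_of_real p \<cdot>\<^sub>m H))
                                     (mat_exp (complex_of_real p \<cdot>\<^sub>m K))) k powr (1 / p))
             \<longlongrightarrow> eig n (mat_exp (complex_of_real (1 - \<alpha>) \<cdot>\<^sub>m H + complex_of_real \<alpha> \<cdot>\<^sub>m K)) k)
            (at_right 0))
       \<and> (\<forall>k\<in>{1..n}.
            eig n (mat_exp (H + K)) k
            \<le> (exp (2 * M) + exp (2 * m)) / (2 * exp M * exp m) *
              eig n (geo_mean n (1 / 2) (mat_exp (2 \<cdot>\<^sub>m H)) (mat_exp (2 \<cdot>\<^sub>m K))) k)"
proof (intro conjI allI impI ballI)
  note bounds = assms(4-7,3)
  let ?X = "complex_of_real (1 - \<alpha>) \<cdot>\<^sub>m H + complex_of_real \<alpha> \<cdot>\<^sub>m K"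
  let ?Z = "\<lambda>p. geo_mean n \<alpha> (mat_exp (complex_of_real p \<cdot>\<^sub>m H)) (mat_exp (complex_of_real p \<cdot>\<^sub>m K))"
  let ?\<kappa> = "\<lambda>p. kantorovich (exp (2 * p * (M - m))) \<alpha>"
  have \<kappa>: "0 < ?\<kappa> p" if "0 < p" for p
    using that assms by (intro kantorovich_pos) auto
  have x: "0 < eig n (mat_exp ?X) k" if "k \<in> {1..n}" for k
    by (rule eig_mat_exp_pos[OF hermitian_combination[OF bounds assms(8,9)] that])
  \<comment> \<open>Positivity comes from the lower bound, whose left side is a product of positive
    numbers.\<close>
  have z: "0 < eig n (?Z p) k" if "0 < p" "k \<in> {1..n}" for p k
    using kantorovich_eig_le[OF bounds assms(8,9) that] \<kappa>[OF that(1)] x[OF that(2)]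
    by (smt (verit) mult_pos_pos powr_gt_zero)
  show lower: "eig n (mat_exp ?X) k \<le> ?\<kappa> p powr (- 1 / p) * eig n (?Z p) k powr (1 / p)"
    if p: "0 < p" and k: "k \<in> {1..n}" for p k
  proof -
    \<comment> \<open>Inserting the constant and its inverse root brings the left side of
      \<open>kantorovich_eig_le\<close> under the root.\<close>
    have "eig n (mat_exp ?X) k = ?\<kappa> p powr (- 1 / p) * (?\<kappa> p * eig n (mat_exp ?X) k powr p) powr (1 / p)"
      using \<kappa>[OF p] x[OF k] p by (simp add: powr_mult powr_powr powr_minus_divide)
    also have "\<dots> \<le> ?\<kappa> p powr (- 1 / p) * eig n (?Z p) k powr (1 / p)"
      using kantorovich_eig_le[OF bounds assms(8,9) p k] \<kappa>[OF p] p
      by (intro mult_left_mono powr_mono2) auto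
    finally show ?thesis .
  qed
  show "((\<lambda>p. ?\<kappa> p powr (- 1 / p) * eig n (?Z p) k powr (1 / p)) \<longlongrightarrow> eig n (mat_exp ?X) k) (at_right 0)"
    if k: "k \<in> {1..n}" for k
  proof (rule tendsto_sandwich)
    define b where "b = 1 + max \<bar>m\<bar> \<bar>M\<bar>"
    have b: "\<bar>m\<bar> \<le> b" "\<bar>M\<bar> \<le> b" "0 < b" by (auto simp: b_def)
    define x where "x = ln (eig n (mat_exp ?X) k)"
    show "\<forall>\<^sub>F p in at_right 0. eig n (mat_exp ?X) k \<le> ?\<kappa> p powr (- 1 / p) * eig n (?Z p) k powr (1 / p)"
      using eventually_at_right_less by eventually_elim (rule lower[OF _ k])
    \<comment> \<open>The range in which \<open>p * b \<le> 1 / 2\<close>, as the quadratic bound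
      requires.\<close>
    have "\<forall>\<^sub>F p in at_right 0. p \<in> {0<..<1 / (2 * b)}"
      using b by (intro eventually_at_right_real) simp
    then show "\<forall>\<^sub>F p in at_right 0. ?\<kappa> p powr (- 1 / p) * eig n (?Z p) k powr (1 / p)
        \<le> ?\<kappa> p powr (- 1 / p) * exp (x + 2 * p * b\<^sup>2)"
    proof eventually_elim
      case (elim p)
      then have p: "0 < p" "p * b \<le> 1 / 2" using b by (auto simp: field_simps)
      have "eig n (?Z p) k \<le> 1 + (p * x + 2 * (p * b)\<^sup>2)"
        using eig_geo_mean_le[OF bounds assms(8,9) p(1) k b(1,2) p(2)] by (simp add: x_def)
      \<comment> \<open>Passing back to an exponential lets the root act on the exponent, where the
        quadratic error becomes \<open>2 * p * b\<^sup>2\<close> and vanishes in the limit.\<close>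
      also have "\<dots> \<le> exp (p * x + 2 * (p * b)\<^sup>2)" by simp
      finally have "eig n (?Z p) k powr (1 / p) \<le> exp (p * x + 2 * (p * b)\<^sup>2) powr (1 / p)"
        using p z[OF p(1) k] by (intro powr_mono2) auto
      also have "\<dots> = exp (x + 2 * p * b\<^sup>2)"
        using p by (simp add: powr_def field_simps power2_eq_square)
      finally show ?case by (intro mult_left_mono) auto
    qed
    have "((\<lambda>p. ?\<kappa> p powr (- 1 / p) * exp (x + 2 * p * b\<^sup>2)) \<longlongrightarrow> 1 * exp (x + 2 * 0 * b\<^sup>2)) (at_right 0)"
      using assms by (intro tendsto_mult[OF kantorovich_root_tendsto] tendsto_intros) auto
    then show "((\<lambda>p. ?\<kappa> p powr (- 1 / p) * exp (x + 2 * p * b\<^sup>2)) \<longlongrightarrow> eig n (mat_exp ?X) k) (at_right 0)"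
      using x[OF k] by (simp add: x_def)
  qed simp
  show "eig n (mat_exp (H + K)) k \<le> (exp (2 * M) + exp (2 * m)) / (2 * exp M * exp m) *
      eig n (geo_mean n (1 / 2) (mat_exp (2 \<cdot>\<^sub>m H)) (mat_exp (2 \<cdot>\<^sub>m K))) k" (is "_ \<le> _ * ?z")
    if k: "k \<in> {1..n}" for k
  proof -
    \<comment> \<open>The last claim is the case \<open>\<alpha> = 1 / 2\<close>,
      \<open>p = 2\<close> for the average \<open>?Y\<close>; squaring its exponential gives that of
      \<open>H + K\<close>.\<close>
    let ?Y = "complex_of_real (1 - 1 / 2) \<cdot>\<^sub>m H + complex_of_real (1 / 2) \<cdot>\<^sub>m K"
    have Y: "hermitian_mat n ?Y"
      by (rule hermitian_combination[OF bounds]) simp_all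
    have "H + K = complex_of_real 2 \<cdot>\<^sub>m ?Y"
      using assms(1,2) by (intro eq_matI) (auto simp: hermitian_mat_def)
    then have "eig n (mat_exp (H + K)) k = eig n (mat_exp ?Y) k powr 2"
      using eig_mat_exp_smult[OF Y k, of 2] by simp
    then have le: "kantorovich (exp (4 * (M - m))) (1 / 2) * eig n (mat_exp (H + K)) k \<le> ?z"
      using kantorovich_eig_le[OF bounds, of "1 / 2" 2 k] k by simp
    have "kantorovich (exp (4 * (M - m))) (1 / 2) = 2 * exp M * exp m / (exp (2 * M) + exp (2 * m))"
      (is "_ = ?c")
    proof -
      have "kantorovich (exp (4 * (M - m))) (1 / 2) = 2 * (exp M / exp m) / ((exp M / exp m)\<^sup>2 + 1)"
        using assms(3) kantorovich_half[of "M - m"] by (simp only: exp_double exp_diff)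
      also have "\<dots> = 2 * exp M * exp m / ((exp M)\<^sup>2 + (exp m)\<^sup>2)"
        by (simp add: divide_simps add_pos_pos power2_eq_square)
      finally show ?thesis by (simp only: exp_double)
    qed
    \<comment> \<open>Without the root the Kantorovich constant enters with exponent -1, and the
      stated factor is its reciprocal.\<close>
    moreover have "0 < ?c" "(exp (2 * M) + exp (2 * m)) / (2 * exp M * exp m) = 1 / ?c"
      by (simp_all add: add_pos_pos)
    ultimately show ?thesis
      using le by (simp only: pos_le_divide_eq mult.commute times_divide_eq_right mult_1_right)
  qed
qed

end
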